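(* Let $H\in W^{1,\infty}(\mathbb R)$. Let $U_0\in L^\infty_{\rm loc}(\mathbb R)$ be piecewise continuous in $\mathbb R$ with finite set of discontinuities $\mathcal J$, and let $A,B>0$ be such that $$|U_0(x)|\le A+B|x|\quad\text{for all }x\in\mathbb R.$$ Let $U$ be the unique global viscosity solution of the Cauchy problem $U_t+H(U_x)=0$ in $\mathbb R\times\mathbb R^+$, $U=U_0$ in $\mathbb R\times\{0\}$. For $x_j\in\mathcal J$ let $J_0(x_j):=U_0(x_j^+)-U_0(x_j^-)$, $J_t(x_j):=U(x_j^+,t)-U(x_j^-,t)$ for $t>0$, and $\tau_j:=\sup\{t>0:J_t(x_j)\ne0\}\in(0,\infty]$. Then for every $x_j\in\mathcal J$ the waiting time $\tau_j$ is finite if either (i) $J_0(x_j)>0$, the limit $H^+:=\lim_{\xi\to\infty}H(\xi)$ exists, and there is no $c>0$ such that $H$ is constant in $(c,\infty)$; or (ii) $J_0(x_j)<0$, the limit $H^-:=\lim_{\xi\to-\infty}H(\xi)$ exists, and there is no $d<0$ such that $H$ is constant in $(-\infty,d)$.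
   Context: **Piecewise continuity.** $f\in L^\infty(a,b)$, $(a,b)$ bounded, is piecewise continuous if there are points $a=x_0<x_1<\dots<x_p<x_{p+1}=b$ such that each restriction $f_j$ of $f$ to $I_j=(x_{j-1},x_j)$ has a representative in $C(\overline{I}_j)$ (again denoted $f_j$), and $f_j(x_j)\ne f_{j+1}(x_j)$ for $j=1,\dots,p$. $f\in L^\infty_{\rm loc}(\mathbb R)$ is piecewise continuous in $\mathbb R$ if it is so in every bounded interval. $U_0(x_j^\pm)$ are the one-sided limits of these representatives. **Viscosity solutions.** For a locally bounded measurable $g$ on $Q=\mathbb R\times(0,T)$, $g^*$ and $g_*$ are the essential upper and lower semicontinuous envelopes on $\overline Q$: $g^*(x_0,t_0)=\lim_{\delta\to0^+}{\rm ess\,sup}_{B_\delta(x_0,t_0)\cap Q}g$, and $g_*$ with ess inf; similarly for functions on $\mathbb R$. $U\in L^\infty_{\rm loc}(\overline Q)$ is a viscosity solution of $U_t+H(U_x)=0$ in $Q$ if for all $\varphi\in C^1(Q)$: $\varphi_t+H(\varphi_x)\le0$ at local maximum points of $U^*-\varphi$ in $Q$ and $\varphi_t+H(\varphi_x)\ge0$ at local minimum points of $U_*-\varphi$ in $Q$; it solves the Cauchy problem with initial data $U_0$ if moreover $U^*(\cdot,0)=(U_0)^*$ and $U_*(\cdot,0)=(U_0)_*$ in $\mathbb R$. It is a global viscosity solution if this holds for all $T>0$. **Known facts fixing notation.** Write $\mathcal J=\{x_1<\dots<x_p\}$. For every $U_0\in L^\infty_{\rm loc}(\mathbb R)$ which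 is piecewise continuous in $\mathbb R$ with finite set of discontinuities $\mathcal J$ there is a unique global viscosity solution. With $x_0=-\infty$, $x_{p+1}=\infty$ and $S_j=(x_{j-1},x_j)\times\mathbb R^+$ ($j=1,\dots,p+1$), the restriction of $U$ to $S_j$ has a continuous representative $\tilde U_j$ in $\overline{S_j}$; $U(x_j^-,t):=\tilde U_j(x_j,t)$, $U(x_j^+,t):=\tilde U_{j+1}(x_j,t)$; and $\tilde U_j(x_j,t)\ne\tilde U_{j+1}(x_j,t)$ if and only if $t\in[0,\tau_j)$. *)

theory Defs
  imports "HOL-Analysis.Analysis" "HOL-Probability.Essential_Supremum"
begin

text \<open>Elements of Lebesgue spaces are rendered by real functions on the whole type; which
  representative modulo null sets is chosen for \<open>U0\<close> and \<open>U\<close> is irrelevant below.\<close>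

definition Linf :: "'a::euclidean_space set \<Rightarrow> ('a \<Rightarrow> real) \<Rightarrow> bool" where
  "Linf S f \<longleftrightarrow>
     f \<in> borel_measurable (lebesgue_on S) \<and> (\<exists>C. AE x in lebesgue_on S. \<bar>f x\<bar> \<le> C)"

definition Linf_loc :: "'a::euclidean_space set \<Rightarrow> ('a \<Rightarrow> real) \<Rightarrow> bool" where
  "Linf_loc S f \<longleftrightarrow> (\<forall>K. compact K \<and> K \<subseteq> S \<longrightarrow> Linf K f)"

text \<open>The Sobolev space $W^{1,\infty}$ of the line; test functions are $C^1$ with compact support.
  This is a condition on the class of \<open>H\<close>; where point values of \<open>H\<close> are used, \<open>H\<close> has to be
  assumed to be the continuous representative.\<close>

definition W1inf :: "(real \<Rightarrow> real) \<Rightarrow> bool" where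
  "W1inf H \<longleftrightarrow> Linf UNIV H \<and>
     (\<exists>H'. Linf UNIV H' \<and>
       (\<forall>\<phi> \<phi>'. (\<forall>x. (\<phi> has_real_derivative \<phi>' x) (at x)) \<and> continuous_on UNIV \<phi>' \<and>
               (\<exists>R. \<forall>x. R < \<bar>x\<bar> \<longrightarrow> \<phi> x = 0) \<longrightarrow>
          (LINT x|lebesgue. H x * \<phi>' x) = - (LINT x|lebesgue. H' x * \<phi> x)))"

subsection \<open>Piecewise continuity\<close>

definition pw_continuous_interval :: "real \<Rightarrow> real \<Rightarrow> (real \<Rightarrow> real) \<Rightarrow> real set \<Rightarrow> bool" where
  "pw_continuous_interval a b f D \<longleftrightarrow> Linf {a<..<b} f \<and>
     (\<exists>(p::nat) (x::nat \<Rightarrow> real) (g::nat \<Rightarrow> real \<Rightarrow> real).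
        x 0 = a \<and> x (p + 1) = b \<and> (\<forall>j\<le>p. x j < x (j + 1)) \<and> D = x ` {1..p} \<and>
        (\<forall>j\<in>{1..p + 1}. continuous_on {x (j - 1)..x j} (g j) \<and>
           (AE y in lebesgue_on {x (j - 1)<..<x j}. f y = g j y)) \<and>
        (\<forall>j\<in>{1..p}. g j (x j) \<noteq> g (j + 1) (x j)))"

text \<open>\<open>pw_continuous f J\<close>: \<open>f\<close> is piecewise continuous in the line and \<open>J\<close> is its set of
  discontinuities. The set \<open>J\<close> is determined by \<open>f\<close>.\<close>

definition pw_continuous :: "(real \<Rightarrow> real) \<Rightarrow> real set \<Rightarrow> bool" where
  "pw_continuous f J \<longleftrightarrow> Linf_loc UNIV f \<and>
     (\<forall>a b. a < b \<longrightarrow> pw_continuous_interval a b f (J \<inter> {a<..<b}))"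

text \<open>One-sided limits at a point of the continuous representatives on the adjacent intervals;
  the limit does not depend on the interval or the representative.\<close>

definition right_limit :: "(real \<Rightarrow> real) \<Rightarrow> real \<Rightarrow> real" where
  "right_limit f x = (THE l. \<exists>b g. x < b \<and> continuous_on {x..b} g \<and>
     (AE y in lebesgue_on {x<..<b}. f y = g y) \<and> (g \<longlongrightarrow> l) (at_right x))"

definition left_limit :: "(real \<Rightarrow> real) \<Rightarrow> real \<Rightarrow> real" where
  "left_limit f x = (THE l. \<exists>a g. a < x \<and> continuous_on {a..x} g \<and>
     (AE y in lebesgue_on {a<..<x}. f y = g y) \<and> (g \<longlongrightarrow> l) (at_left x))"

subsection \<open>Viscosity solutions\<close>

text \<open>Essential semicontinuous envelopes of a function on \<open>Q\<close>, to be evaluated at points of the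
  closure of \<open>Q\<close>. For locally bounded functions the extended real limits are finite. The essential
  infimum is minus the essential supremum of the negative.\<close>

definition upper_env :: "'a::euclidean_space set \<Rightarrow> ('a \<Rightarrow> real) \<Rightarrow> 'a \<Rightarrow> real" where
  "upper_env Q g z = real_of_ereal
     (Lim (at_right (0::real)) (\<lambda>\<delta>. esssup (lebesgue_on (ball z \<delta> \<inter> Q)) (\<lambda>w. ereal (g w))))"

definition lower_env :: "'a::euclidean_space set \<Rightarrow> ('a \<Rightarrow> real) \<Rightarrow> 'a \<Rightarrow> real" where
  "lower_env Q g z = real_of_ereal
     (Lim (at_right (0::real)) (\<lambda>\<delta>. - esssup (lebesgue_on (ball z \<delta> \<inter> Q)) (\<lambda>w. ereal (- g w))))"

definition local_max_in :: "'a::metric_space set \<Rightarrow> ('a \<Rightarrow> real) \<Rightarrow> 'a \<Rightarrow> bool" where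
  "local_max_in Q f z \<longleftrightarrow> z \<in> Q \<and> (\<exists>\<delta>>0. \<forall>w\<in>ball z \<delta> \<inter> Q. f w \<le> f z)"

definition local_min_in :: "'a::metric_space set \<Rightarrow> ('a \<Rightarrow> real) \<Rightarrow> 'a \<Rightarrow> bool" where
  "local_min_in Q f z \<longleftrightarrow> z \<in> Q \<and> (\<exists>\<delta>>0. \<forall>w\<in>ball z \<delta> \<inter> Q. f z \<le> f w)"

text \<open>Points of the plane are written (space, time). \<open>C1_partials Q \<phi> \<phi>x \<phi>t\<close>: \<open>\<phi>\<close> is of class
  $C^1$ in the open set \<open>Q\<close>, with partial derivatives \<open>\<phi>x\<close>, \<open>\<phi>t\<close>.\<close>

definition C1_partials ::
  "(real \<times> real) set \<Rightarrow> (real \<times> real \<Rightarrow> real) \<Rightarrow> (real \<times> real \<Rightarrow> real) \<Rightarrow> (real \<times> real \<Rightarrow> real) \<Rightarrow> bool"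
where
  "C1_partials Q \<phi> \<phi>x \<phi>t \<longleftrightarrow> continuous_on Q \<phi>x \<and> continuous_on Q \<phi>t \<and>
     (\<forall>z\<in>Q. (\<phi> has_derivative (\<lambda>(h, k). \<phi>x z * h + \<phi>t z * k)) (at z))"

definition Q_domain :: "real \<Rightarrow> (real \<times> real) set" where
  "Q_domain T = UNIV \<times> {0<..<T}"

definition viscosity_solution ::
  "(real \<Rightarrow> real) \<Rightarrow> real \<Rightarrow> (real \<times> real \<Rightarrow> real) \<Rightarrow> bool" where
  "viscosity_solution H T U \<longleftrightarrow> Linf_loc (closure (Q_domain T)) U \<and>
     (\<forall>\<phi> \<phi>x \<phi>t. C1_partials (Q_domain T) \<phi> \<phi>x \<phi>t \<longrightarrow>
        (\<forall>z. local_max_in (Q_domain T) (\<lambda>w. upper_env (Q_domain T) U w - \<phi> w) z \<longrightarrow>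
             \<phi>t z + H (\<phi>x z) \<le> 0) \<and>
        (\<forall>z. local_min_in (Q_domain T) (\<lambda>w. lower_env (Q_domain T) U w - \<phi> w) z \<longrightarrow>
             \<phi>t z + H (\<phi>x z) \<ge> 0))"

definition cauchy_viscosity_solution ::
  "(real \<Rightarrow> real) \<Rightarrow> (real \<Rightarrow> real) \<Rightarrow> real \<Rightarrow> (real \<times> real \<Rightarrow> real) \<Rightarrow> bool" where
  "cauchy_viscosity_solution H U0 T U \<longleftrightarrow> viscosity_solution H T U \<and>
     (\<forall>x. upper_env (Q_domain T) U (x, 0) = upper_env UNIV U0 x) \<and>
     (\<forall>x. lower_env (Q_domain T) U (x, 0) = lower_env UNIV U0 x)"

definition global_viscosity_solution ::
  "(real \<Rightarrow> real) \<Rightarrow> (real \<Rightarrow> real) \<Rightarrow> (real \<times> real \<Rightarrow> real) \<Rightarrow> bool" where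
  "global_viscosity_solution H U0 U \<longleftrightarrow> (\<forall>T>0. cauchy_viscosity_solution H U0 T U)"

subsection \<open>Jumps and waiting times\<close>

text \<open>For points \<open>x 1 < \<dots> < x p\<close>, with the convention that \<open>x 0\<close> and \<open>x (p + 1)\<close> are minus and
  plus infinity; the values of the function \<open>x\<close> outside \<open>{1..p}\<close> are irrelevant.\<close>

definition strip :: "nat \<Rightarrow> (nat \<Rightarrow> real) \<Rightarrow> nat \<Rightarrow> (real \<times> real) set" where
  "strip p x j = {(y, t). (1 < j \<longrightarrow> x (j - 1) < y) \<and> (j \<le> p \<longrightarrow> y < x j) \<and> 0 < t}"

definition continuous_representative ::
  "'a::euclidean_space set \<Rightarrow> ('a \<Rightarrow> real) \<Rightarrow> ('a \<Rightarrow> real) \<Rightarrow> bool" where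
  "continuous_representative S U V \<longleftrightarrow>
     continuous_on (closure S) V \<and> (AE z in lebesgue_on S. U z = V z)"

definition initial_jump :: "(real \<Rightarrow> real) \<Rightarrow> real \<Rightarrow> real" where
  "initial_jump U0 y = right_limit U0 y - left_limit U0 y"

text \<open>Here \<open>V j\<close> is the continuous representative of the solution on the closure of the
  \<open>j\<close>-th strip, so \<open>V (j + 1)\<close> and \<open>V j\<close> give the right and left traces at \<open>x j\<close>.\<close>

definition jump ::
  "(nat \<Rightarrow> real \<times> real \<Rightarrow> real) \<Rightarrow> (nat \<Rightarrow> real) \<Rightarrow> nat \<Rightarrow> real \<Rightarrow> real" where
  "jump V x j t = V (j + 1) (x j, t) - V j (x j, t)"

definition waiting_time ::
  "(nat \<Rightarrow> real \<times> real \<Rightarrow> real) \<Rightarrow> (nat \<Rightarrow> real) \<Rightarrow> nat \<Rightarrow> ereal" where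
  "waiting_time V x j = Sup (ereal ` {t. 0 < t \<and> jump V x j t \<noteq> 0})"

end

theory Submission
  imports Defs
begin

text \<open>Consider an upward jump at the point \<open>y\<close>, with left trace \<open>l\<close> below the right trace \<open>r\<close>. At a point of
the line \<open>x = y\<close> the lower envelope of the solution equals \<open>l\<close>, and just to the right of it the envelope
is strictly larger. So the supersolution inequality holds at a minimum over the closed left half plane
that lies on the line as if the line were interior. This takes the place of a boundary condition when the
solution on the left is compared with an affine function \<open>m + a (x - y) - H a (t - s)\<close>
(\<open>left_trace_lower_bound\<close>). Besides being below the solution at time \<open>s\<close>, this function only has to be below it far
away. Boundedness of \<open>H\<close> preserves the linear growth with rate \<open>B\<close> for all times
(\<open>linear_growth\<close>), so any slope \<open>a > B\<close> is admissible. This yields \<open>l t \<ge> m - H a (t - s)\<close> as long as the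
jump is positive. The symmetric argument on the right gives \<open>r t \<le> M - H b (t - s)\<close> for every slope
\<open>b > B\<close>.

Two choices of the slopes give the theorem. As \<open>H\<close> is not constant beyond \<open>B\<close>, there are slopes with
\<open>H a < H b\<close>; then the jump is bounded above by a constant minus \<open>(H b - H a) t\<close> and has to vanish at some
time (\<open>upward_jump_closes\<close>). Once the traces agree, the solution is continuous at that point and a single
very large slope serves on both sides with \<open>m\<close> and \<open>M\<close> arbitrarily close to the common value; the
two speeds are then equal, so the jump stays nonpositive (\<open>no_upward_jump_created\<close>), and by
reflection also nonnegative. Hence the set of times with a nonzero jump is bounded. A downward jump
becomes an upward one under \<open>x \<mapsto> 2 y - x\<close>, which replaces \<open>H\<close> by \<open>\<xi> \<mapsto> H (- \<xi>)\<close>.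

What remains is to pass between the almost everywhere notions in the definitions and pointwise
ones: the envelopes are semicontinuous, agree with the continuous representatives off the
line, and equal the minimum and the maximum of the traces on it (\<open>lower_env_at_jump\<close>).\<close>

section \<open>Comparison with smooth barriers on a rectangle\<close>

definition lsc_on :: "'a::metric_space set \<Rightarrow> ('a \<Rightarrow> real) \<Rightarrow> bool" where
  "lsc_on S f \<longleftrightarrow> (\<forall>z\<in>S. \<forall>c<f z. \<exists>d>0. \<forall>w\<in>S \<inter> ball z d. c < f w)"

lemma lsc_on_subset: "lsc_on S f \<Longrightarrow> R \<subseteq> S \<Longrightarrow> lsc_on R f"
  unfolding lsc_on_def
proof (intro ballI allI impI)
  fix z c assume *: "\<forall>z\<in>S. \<forall>c<f z. \<exists>d>0. \<forall>w\<in>S \<inter> ball z d. c < f w" "R \<subseteq> S" "z \<in> R" "c < f z"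
  then obtain d where "d > 0" "\<forall>w\<in>S \<inter> ball z d. c < f w" by (meson subsetD)
  with * show "\<exists>d>0. \<forall>w\<in>R \<inter> ball z d. c < f w" by (intro exI[of _ d]) auto
qed

lemma lsc_on_attains_min:
  assumes "compact S" "S \<noteq> {}" "lsc_on S f"
  shows "\<exists>z\<in>S. \<forall>w\<in>S. f z \<le> f w"
proof (rule ccontr)
  assume "\<not> ?thesis"
  then have "\<forall>z\<in>S. \<exists>w\<in>S. f w < f z" by (auto simp: not_le)
  then obtain W where W: "\<And>z. z \<in> S \<Longrightarrow> W z \<in> S \<and> f (W z) < f z" by metis
  have "\<forall>z\<in>S. \<exists>d>0. \<forall>w\<in>S \<inter> ball z d. f (W z) < f w"
    using assms(3) W unfolding lsc_on_def by blast
  then obtain D where D: "\<And>z. z \<in> S \<Longrightarrow> D z > 0 \<and> (\<forall>w\<in>S \<inter> ball z (D z). f (W z) < f w)" by metis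
  have cov: "S \<subseteq> (\<Union>z\<in>S. ball z (D z))" using D by force
  obtain K where K: "K \<subseteq> S" "finite K" "S \<subseteq> (\<Union>z\<in>K. ball z (D z))"
    by (rule compactE_image[OF assms(1) _ cov]) auto
  have "K \<noteq> {}" using K assms(2) by auto
  then obtain z1 where z1: "z1 \<in> K" "\<And>z. z \<in> K \<Longrightarrow> f (W z1) \<le> f (W z)"
    using ex_is_arg_min_if_finite[OF K(2), of "\<lambda>z. f (W z)"] by (auto simp: is_arg_min_linorder)
  have "W z1 \<in> S" using W z1 K by auto
  then obtain z where "z \<in> K" "W z1 \<in> ball z (D z)" using K by auto
  then have "f (W z) < f (W z1)" using D[of z] K \<open>W z1 \<in> S\<close> by auto
  with z1(2)[OF \<open>z \<in> K\<close>] show False by simp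
qed

lemma lsc_on_diff_continuous:
  assumes "lsc_on S f" "continuous_on S g"
  shows "lsc_on S (\<lambda>z. f z - g z)"
  unfolding lsc_on_def
proof (intro ballI allI impI)
  fix z c assume z: "z \<in> S" and c: "c < f z - g z"
  define e where "e = (f z - g z - c) / 2"
  have e: "e > 0" using c by (simp add: e_def)
  obtain d1 where d1: "d1 > 0" "\<forall>w\<in>S \<inter> ball z d1. f z - e < f w"
    using assms(1)[unfolded lsc_on_def, rule_format, OF z, of "f z - e"] e by auto
  obtain d2 where d2: "d2 > 0" "\<forall>w\<in>S. dist w z < d2 \<longrightarrow> dist (g w) (g z) < e"
    using assms(2) z e unfolding continuous_on_iff by meson
  show "\<exists>d>0. \<forall>w\<in>S \<inter> ball z d. c < f w - g w"
  proof (intro exI conjI ballI)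
    show "min d1 d2 > 0" using d1 d2 by simp
    fix w assume w: "w \<in> S \<inter> ball z (min d1 d2)"
    then have "f z - e < f w" "dist (g w) (g z) < e" using d1 d2 by (auto simp: dist_commute)
    then show "c < f w - g w" unfolding e_def dist_real_def by (simp add: field_simps abs_if split: if_splits)
  qed
qed

text \<open>The supersolution half of the notion of viscosity solution, for a function given pointwise. It is
meant for the lower envelope. The subsolution half is the same notion for the negative of the upper
envelope and the Hamiltonian \<open>\<xi> \<mapsto> - H (- \<xi>)\<close>, so that every estimate from below also serves as an
estimate from above.\<close>

definition supersolution :: "(real \<Rightarrow> real) \<Rightarrow> real \<Rightarrow> (real \<times> real \<Rightarrow> real) \<Rightarrow> bool" where
  "supersolution H T G \<longleftrightarrow>
     (\<forall>\<phi> \<phi>x \<phi>t z. C1_partials (Q_domain T) \<phi> \<phi>x \<phi>t \<longrightarrow>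
        local_min_in (Q_domain T) (\<lambda>w. G w - \<phi> w) z \<longrightarrow> \<phi>t z + H (\<phi>x z) \<ge> 0)"

text \<open>The barriers are \<open>g x - k (t - s)\<close>. The term \<open>\<eta> / (T - t)\<close> pushes the barrier to minus infinity at
the final time, which keeps minimum points away from it, and makes the barrier a strict
subsolution.\<close>

lemma C1_partials_barrier:
  assumes g: "\<And>x. (g has_real_derivative g' x) (at x)" "continuous_on UNIV g'"
  shows "C1_partials (Q_domain T) (\<lambda>z. g (fst z) - k * (snd z - s) - \<eta> / (T - snd z))
           (\<lambda>z. g' (fst z)) (\<lambda>z. - k - \<eta> / (T - snd z)^2)"
  unfolding C1_partials_def
proof (intro conjI ballI)
  show "continuous_on (Q_domain T) (\<lambda>z. g' (fst z))"
    by (intro continuous_on_compose2[OF g(2)] continuous_intros) auto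
  show "continuous_on (Q_domain T) (\<lambda>z. - k - \<eta> / (T - snd z)^2)"
    by (intro continuous_intros) (auto simp: Q_domain_def)
  fix z :: "real \<times> real" assume z: "z \<in> Q_domain T"
  have 1: "((\<lambda>z::real\<times>real. g (fst z)) has_derivative (\<lambda>h. fst h * g' (fst z))) (at z)"
    using has_derivative_compose[OF has_derivative_fst[OF has_derivative_ident] , of g "(\<lambda>h. h * g' (fst z))" z UNIV]
      g(1)[of "fst z"] by (simp add: has_field_derivative_def mult.commute[of _ "g' (fst z)"])
  have "snd z < T" using z by (auto simp: Q_domain_def)
  then have 2: "((\<lambda>z. g (fst z) - k * (snd z - s) - \<eta> / (T - snd z)) has_derivative
     (\<lambda>h. fst h * g' (fst z) - k * snd h - \<eta> * snd h / (T - snd z)^2)) (at z)"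
    by (auto intro!: derivative_eq_intros 1 simp: power2_eq_square field_simps)
  show "((\<lambda>z. g (fst z) - k * (snd z - s) - \<eta> / (T - snd z)) has_derivative
      (\<lambda>(h, k'). g' (fst z) * h + (- k - \<eta> / (T - snd z)\<^sup>2) * k')) (at z)"
    by (rule has_derivative_eq_rhs[OF 2]) (auto simp: fun_eq_iff algebra_simps)
qed

text \<open>If \<open>G\<close> were below the barrier somewhere, then \<open>G\<close> minus the penalised barrier would have a negative
minimum over the rectangle. It lies neither at the initial time nor on a side where the barrier is
known to be below \<open>G\<close>, so the equation applies there and contradicts \<open>H (g' x) \<le> k\<close>. A single
test function is enough, as the barrier is smooth.

The second alternative for the right side is what makes the lemma useful at a discontinuity: if \<open>G\<close>
jumps up across that side, then a minimum over the rectangle on this side is a local minimum in the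
plane, whatever the slope of the barrier.\<close>

lemma rectangle_comparison:
  fixes g g' :: "real \<Rightarrow> real"
  assumes super: "supersolution H T G" and lsc: "lsc_on (UNIV \<times> {0..}) G"
    and s: "0 \<le> s" "s < T"
    and g: "\<And>x. (g has_real_derivative g' x) (at x)" "continuous_on UNIV g'"
    and slope: "\<And>x. x \<in> {\<alpha>..\<beta>} \<Longrightarrow> H (g' x) \<le> k"
    and init: "\<And>x. x \<in> {\<alpha>..\<beta>} \<Longrightarrow> g x \<le> G (x, s)"
    and left: "\<And>t. s < t \<Longrightarrow> t < T \<Longrightarrow> g \<alpha> - k * (t - s) \<le> G (\<alpha>, t)"
    and right: "\<And>t. s < t \<Longrightarrow> t < T \<Longrightarrow> g \<beta> - k * (t - s) \<le> G (\<beta>, t) \<or>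
       (\<exists>c>G (\<beta>, t). \<exists>d>0. \<forall>w\<in>ball (\<beta>, t) d. \<beta> < fst w \<longrightarrow> c \<le> G w)"
    and xt: "x \<in> {\<alpha>..\<beta>}" "s \<le> t" "t < T"
  shows "g x - k * (t - s) \<le> G (x, t)"
proof (rule ccontr)
  assume neg: "\<not> ?thesis"
  define \<phi> where "\<phi> = (\<lambda>z::real\<times>real. g (fst z) - k * (snd z - s))"
  have g_cont: "continuous_on UNIV g"
    using g(1) by (meson DERIV_isCont continuous_at_imp_continuous_on)
  have \<phi>_cont: "continuous_on X \<phi>" for X
    unfolding \<phi>_def by (intro continuous_intros continuous_on_compose2[OF g_cont]) auto
  define R where "R = {\<alpha>..\<beta>} \<times> {s..T}"
  have R: "compact R" "R \<noteq> {}" "R \<subseteq> UNIV \<times> {0..}" using xt s by (auto simp: R_def compact_Times)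
  have lscR: "lsc_on R (\<lambda>z. G z - \<phi> z)"
    by (intro lsc_on_diff_continuous lsc_on_subset[OF lsc] R(3) \<phi>_cont)
  obtain z1 where z1: "\<forall>w\<in>R. G z1 - \<phi> z1 \<le> G w - \<phi> w"
    using lsc_on_attains_min[OF R(1,2) lscR] by auto
  define M where "M = 1 + \<bar>G z1 - \<phi> z1\<bar>"
  have M: "M > 0" by (simp add: M_def)
  have M_bound: "- M < G w - \<phi> w" if "w \<in> R" for w
    using z1[rule_format, OF that] unfolding M_def by linarith
  define d where "d = \<phi> (x, t) - G (x, t)"
  have d: "d > 0" using neg by (simp add: d_def \<phi>_def)
  \<comment> \<open>Small enough for the penalised barrier still to exceed \<open>G\<close> at \<open>(x, t)\<close>.\<close>
  define \<eta> where "\<eta> = d * (T - t) / 2"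
  have \<eta>: "\<eta> > 0" using d xt by (simp add: \<eta>_def)
  define F where "F = (\<lambda>w. G w - (\<phi> w - \<eta> / (T - snd w)))"
  have "T - t \<noteq> 0" using xt by simp
  moreover have "\<eta> = d / 2 * (T - t)" by (simp add: \<eta>_def)
  ultimately have "\<eta> / (T - t) = d / 2" by (metis nonzero_mult_div_cancel_right)
  moreover have "\<phi> (x, t) - G (x, t) = d" by (simp add: d_def)
  ultimately have Fneg: "F (x, t) < 0" using d unfolding F_def snd_conv by (smt (verit) field_sum_of_halves)
  \<comment> \<open>After this time the penalty exceeds \<open>M\<close>, so the minimum cannot be there.\<close>
  define T' where "T' = max t (T - \<eta> / M)"
  have T': "t \<le> T'" "T' < T" using xt \<eta> M by (auto simp: T'_def)
  define R' where "R' = {\<alpha>..\<beta>} \<times> {s..T'}"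
  have R': "compact R'" "R' \<noteq> {}" "R' \<subseteq> R" using xt T' by (auto simp: R_def R'_def compact_Times)
  have "continuous_on R' (\<lambda>w. \<phi> w - \<eta> / (T - snd w))"
    using T' by (intro continuous_intros \<phi>_cont) (auto simp: R'_def)
  then have "lsc_on R' F" unfolding F_def
    by (intro lsc_on_diff_continuous lsc_on_subset[OF lsc]) (use R' R in auto)
  then obtain z0 where z0: "z0 \<in> R'" "\<And>w. w \<in> R' \<Longrightarrow> F z0 \<le> F w"
    using lsc_on_attains_min[OF R'(1,2)] by blast
  have F0: "F z0 < 0" using z0(2)[of "(x, t)"] Fneg xt T' by (auto simp: R'_def)
  have z0min: "F z0 \<le> F w" if w: "w \<in> R" "snd w < T" for w
  proof (cases "snd w \<le> T'")
    case True
    then show ?thesis using z0(2)[of w] w by (auto simp: R_def R'_def)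
  next
    case False
    then have "T - snd w < \<eta> / M" by (auto simp: T'_def)
    then have "M < \<eta> / (T - snd w)" using w M \<eta> by (simp add: field_simps)
    then have "F w > 0" using M_bound[OF w(1)] by (simp add: F_def)
    then show ?thesis using F0 by simp
  qed
  obtain x0 t0 where z0e: "z0 = (x0, t0)" by (cases z0)
  have x0: "\<alpha> \<le> x0" "x0 \<le> \<beta>" and t0: "s \<le> t0" "t0 < T" using z0(1) T' by (auto simp: R'_def z0e)
  have pen: "\<eta> / (T - t0) > 0" using \<eta> t0 by simp
  have Glt: "G (x0, t0) < g x0 - k * (t0 - s)" using F0 pen by (simp add: F_def z0e \<phi>_def)
  then have t0s: "s < t0" using init[of x0] x0 t0 by (cases "s = t0") auto
  have x0a: "\<alpha> < x0" using left[OF t0s t0(2)] Glt x0 by (cases "\<alpha> = x0") auto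
  have "local_min_in (Q_domain T) F z0"
  proof -
    define e0 where "e0 = Min {x0 - \<alpha>, t0 - s}"
    have e0: "e0 > 0" using x0a t0s by (auto simp: e0_def)
    have near: "\<alpha> < fst w \<and> s < snd w" if "w \<in> ball z0 e0" for w
    proof -
      have "dist x0 (fst w) < e0" "dist t0 (snd w) < e0"
        using that dist_fst_le[of z0 w] dist_snd_le[of z0 w] by (auto simp: z0e)
      then show ?thesis by (auto simp: e0_def dist_real_def)
    qed
    have "\<exists>e1>0. \<forall>w\<in>ball z0 e1 \<inter> Q_domain T. \<beta> < fst w \<longrightarrow> F z0 \<le> F w"
    proof (cases "x0 = \<beta>")
      case False
      then have "\<beta> - x0 > 0" using x0 by simp
      moreover have "fst w \<le> \<beta>" if "w \<in> ball z0 (\<beta> - x0)" for w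
        using that dist_fst_le[of z0 w] by (auto simp: z0e dist_real_def)
      ultimately show ?thesis by (meson IntD1 not_less)
    next
      case True
      then obtain c d1 where c: "c > G z0" "d1 > 0" "\<And>w. w\<in>ball z0 d1 \<Longrightarrow> \<beta> < fst w \<Longrightarrow> c \<le> G w"
        using right[OF t0s t0(2)] Glt z0e by auto
      define \<psi> where "\<psi> = (\<lambda>w. \<phi> w - \<eta> / (T - snd w))"
      have "continuous_on (UNIV \<times> {..<T}) \<psi>" unfolding \<psi>_def
        by (intro continuous_intros \<phi>_cont) auto
      moreover have "z0 \<in> UNIV \<times> {..<T}" using t0 z0e by auto
      ultimately obtain d2 where d2: "d2 > 0"
         "\<forall>w\<in>UNIV \<times> {..<T}. dist w z0 < d2 \<longrightarrow> dist (\<psi> w) (\<psi> z0) < c - G z0"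
        using c(1) unfolding continuous_on_iff by (meson diff_gt_0_iff_gt)
      show ?thesis
      proof (intro exI[of _ "min d1 d2"] conjI ballI impI)
        show "min d1 d2 > 0" using c d2 by simp
        fix w assume w: "w \<in> ball z0 (min d1 d2) \<inter> Q_domain T" "\<beta> < fst w"
        then have "w \<in> UNIV \<times> {..<T}" by (auto simp: Q_domain_def)
        then have "dist (\<psi> w) (\<psi> z0) < c - G z0" using d2(2) w by (auto simp: dist_commute)
        moreover have "c \<le> G w" using c(3)[of w] w by auto
        ultimately show "F z0 \<le> F w" unfolding F_def \<psi>_def[symmetric]
          by (auto simp: dist_real_def \<psi>_def)
      qed
    qed
    then obtain e1 where e1: "e1 > 0" "\<And>w. w\<in>ball z0 e1 \<Longrightarrow> w \<in> Q_domain T \<Longrightarrow> \<beta> < fst w \<Longrightarrow> F z0 \<le> F w"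
      by blast
    show ?thesis unfolding local_min_in_def
    proof (intro conjI exI[of _ "min e0 e1"] ballI)
      show "z0 \<in> Q_domain T" using t0 t0s s by (auto simp: z0e Q_domain_def)
      show "min e0 e1 > 0" using e0 e1 by simp
      fix w assume w: "w \<in> ball z0 (min e0 e1) \<inter> Q_domain T"
      show "F z0 \<le> F w"
      proof (cases "\<beta> < fst w")
        case True
        then show ?thesis using e1(2)[of w] w by auto
      next
        case False
        then have "w \<in> R" "snd w < T" using near[of w] w by (auto simp: R_def Q_domain_def mem_Times_iff)
        then show ?thesis using z0min by blast
      qed
    qed
  qed
  then have "local_min_in (Q_domain T) (\<lambda>w. G w - (g (fst w) - k * (snd w - s) - \<eta> / (T - snd w))) z0"
    by (simp add: F_def \<phi>_def)
  from super[unfolded supersolution_def, rule_format, OF C1_partials_barrier[OF g] this]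
  have "0 \<le> - k - \<eta> / (T - t0)^2 + H (g' x0)" by (simp add: z0e)
  moreover have "\<eta> / (T - t0)^2 > 0" using \<eta> t0 by simp
  ultimately show False using slope[of x0] x0 by auto
qed

section \<open>Reflection in space\<close>

definition reflect :: "real \<Rightarrow> real \<times> real \<Rightarrow> real \<times> real" where
  "reflect y z = (2 * y - fst z, snd z)"

lemma reflect_simps [simp]:
  "reflect y (x, t) = (2 * y - x, t)" "reflect y (reflect y z) = z"
  "fst (reflect y z) = 2 * y - fst z" "snd (reflect y z) = snd z"
  by (simp_all add: reflect_def)

lemma dist_reflect: "dist (reflect y z) (reflect y w) = dist z w"
  by (cases z; cases w) (simp add: reflect_def dist_Pair_Pair dist_real_def abs_minus_commute)

lemma reflect_mem_ball: "reflect y w \<in> ball (reflect y z) d \<longleftrightarrow> w \<in> ball z d"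
  by (simp add: dist_reflect)

lemma reflect_mem_Q_domain [simp]: "reflect y z \<in> Q_domain T \<longleftrightarrow> z \<in> Q_domain T"
  by (auto simp: Q_domain_def mem_Times_iff)

lemma continuous_on_reflect: "continuous_on S (reflect y)"
  unfolding reflect_def by (intro continuous_intros)

lemma has_derivative_reflect: "(reflect y has_derivative (\<lambda>h. (- fst h, snd h))) (at z)"
  unfolding reflect_def by (auto intro!: derivative_eq_intros)

text \<open>Reflection replaces the slope of a test function by its negative. It exchanges the two sides of a
jump, so that only one side has to be treated.\<close>

lemma supersolution_reflect:
  assumes "supersolution H T G"
  shows "supersolution (\<lambda>\<xi>. H (- \<xi>)) T (\<lambda>z. G (reflect y z))"
  unfolding supersolution_def
proof (intro allI impI)
  fix \<phi> \<phi>x \<phi>t z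
  assume C1: "C1_partials (Q_domain T) \<phi> \<phi>x \<phi>t"
    and lm: "local_min_in (Q_domain T) (\<lambda>w. G (reflect y w) - \<phi> w) z"
  have "C1_partials (Q_domain T) (\<lambda>w. \<phi> (reflect y w)) (\<lambda>w. - \<phi>x (reflect y w)) (\<lambda>w. \<phi>t (reflect y w))"
    unfolding C1_partials_def
  proof (intro conjI ballI)
    have *: "continuous_on (Q_domain T) (\<lambda>w. f (reflect y w))" if "continuous_on (Q_domain T) f" for f :: "real \<times> real \<Rightarrow> real"
      by (rule continuous_on_compose2[OF that continuous_on_reflect]) (auto simp: Q_domain_def)
    show "continuous_on (Q_domain T) (\<lambda>w. - \<phi>x (reflect y w))"
      "continuous_on (Q_domain T) (\<lambda>w. \<phi>t (reflect y w))"
      using C1 by (auto simp: C1_partials_def intro!: * continuous_intros)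
    fix w assume "w \<in> Q_domain T"
    then have "(\<phi> has_derivative (\<lambda>(h, k). \<phi>x (reflect y w) * h + \<phi>t (reflect y w) * k)) (at (reflect y w))"
      using C1 by (auto simp: C1_partials_def)
    from has_derivative_compose[OF has_derivative_reflect this]
    show "((\<lambda>w. \<phi> (reflect y w)) has_derivative
       (\<lambda>(h, k). - \<phi>x (reflect y w) * h + \<phi>t (reflect y w) * k)) (at w)"
      by (rule has_derivative_eq_rhs) (auto simp: fun_eq_iff)
  qed
  moreover have "local_min_in (Q_domain T) (\<lambda>w. G w - \<phi> (reflect y w)) (reflect y z)"
  proof -
    obtain d where d: "z \<in> Q_domain T" "d > 0"
      "\<And>w. w \<in> ball z d \<Longrightarrow> w \<in> Q_domain T \<Longrightarrow> G (reflect y z) - \<phi> z \<le> G (reflect y w) - \<phi> w"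
      using lm unfolding local_min_in_def reflect_simps(2) by blast
    have "G (reflect y z) - \<phi> z \<le> G w - \<phi> (reflect y w)"
      if "w \<in> ball (reflect y z) d" "w \<in> Q_domain T" for w
      using d(3)[of "reflect y w"] that reflect_mem_ball[of y "reflect y w" z d] by simp
    then show ?thesis unfolding local_min_in_def using d by auto
  qed
  ultimately have "0 \<le> \<phi>t (reflect y (reflect y z)) + H (- \<phi>x (reflect y (reflect y z)))"
    using assms[unfolded supersolution_def] by blast
  then show "0 \<le> \<phi>t z + H (- \<phi>x z)" by simp
qed

lemma lsc_on_reflect:
  assumes "lsc_on (UNIV \<times> S) G"
  shows "lsc_on (UNIV \<times> S) (\<lambda>z. G (reflect y z))"
  unfolding lsc_on_def
proof (intro ballI allI impI)
  fix z c assume z: "z \<in> UNIV \<times> S" "c < G (reflect y z)"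
  have rS: "reflect y w \<in> UNIV \<times> S \<longleftrightarrow> w \<in> UNIV \<times> S" for w by (auto simp: mem_Times_iff)
  obtain d where d: "d > 0" "\<And>w. w \<in> UNIV \<times> S \<Longrightarrow> w \<in> ball (reflect y z) d \<Longrightarrow> c < G w"
    using assms[unfolded lsc_on_def, rule_format, of "reflect y z" c] z rS by auto
  show "\<exists>d>0. \<forall>w\<in>UNIV \<times> S \<inter> ball z d. c < G (reflect y w)"
  proof (intro exI[of _ d] conjI ballI)
    fix w assume "w \<in> UNIV \<times> S \<inter> ball z d"
    then show "c < G (reflect y w)" using d(2)[of "reflect y w"] rS reflect_mem_ball by blast
  qed (use d in auto)
qed

section \<open>A supersolution with a jump along a vertical line\<close>

text \<open>\<open>G\<close> stands for the lower envelope of a function that is continuous on both sides of the line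
\<open>x = y\<close>, with left and right traces \<open>l\<close> and \<open>r\<close>. The one-sided bounds near the line are stated
for \<open>G\<close> itself, so that the locale is stable under reflection, which exchanges \<open>l\<close> and \<open>r\<close>.

The negative of the upper envelope satisfies the same assumptions for \<open>\<xi> \<mapsto> - H (- \<xi>)\<close>, \<open>- l\<close> and
\<open>- r\<close>; if it is reflected as well, for \<open>- H\<close>, \<open>- r\<close> and \<open>- l\<close>. In the last form the jump has the
same sign as that of \<open>G\<close>; this is the form in which the upper envelope appears below.\<close>

locale supersolution_at_jump =
  fixes H :: "real \<Rightarrow> real" and G :: "real \<times> real \<Rightarrow> real" and y :: real
    and l r :: "real \<Rightarrow> real" and A B C :: real
  assumes B_nonneg: "0 \<le> B"
    and H_bounded: "\<bar>H \<xi>\<bar> \<le> C"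
    and super: "0 < T \<Longrightarrow> supersolution H T G"
    and lsc: "lsc_on (UNIV \<times> {0..}) G"
    and initial: "- A - B * \<bar>x - y\<bar> \<le> G (x, 0)"
    and cont: "continuous_on {0..} l" "continuous_on {0..} r"
    and at_y: "0 \<le> t \<Longrightarrow> G (y, t) = min (l t) (r t)"
    and right_of_y: "0 < t \<Longrightarrow> c < r t \<Longrightarrow> \<exists>d>0. \<forall>w\<in>ball (y, t) d. y < fst w \<longrightarrow> c \<le> G w"
    and left_of_y: "0 < t \<Longrightarrow> c < l t \<Longrightarrow> \<exists>d>0. \<forall>w\<in>ball (y, t) d. fst w < y \<longrightarrow> c \<le> G w"
begin

lemma reflected: "supersolution_at_jump (\<lambda>\<xi>. H (- \<xi>)) (\<lambda>z. G (reflect y z)) y r l A B C"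
proof
  fix x :: real
  show "- A - B * \<bar>x - y\<bar> \<le> G (reflect y (x, 0))"
    using initial[of "2 * y - x"] by (simp add: abs_minus_commute)
next
  have *: "\<exists>d>0. \<forall>w\<in>ball (y, t) d. P (fst w) \<longrightarrow> c \<le> G (reflect y w)"
    if "\<exists>d>0. \<forall>w\<in>ball (y, t) d. P (2 * y - fst w) \<longrightarrow> c \<le> G w" for P c t
  proof -
    obtain d where d: "d > 0" "\<And>w. w \<in> ball (y, t) d \<Longrightarrow> P (2 * y - fst w) \<Longrightarrow> c \<le> G w"
      using \<open>\<exists>d>0. _\<close> by auto
    have "c \<le> G (reflect y w)" if "w \<in> ball (y, t) d" "P (fst w)" for w
      using d(2)[of "reflect y w"] reflect_mem_ball[of y w "(y, t)" d] that by simp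
    then show ?thesis using d by auto
  qed
  fix c t :: real assume t: "0 < t"
  { assume "c < l t"
    from left_of_y[OF t this] show "\<exists>d>0. \<forall>w\<in>ball (y, t) d. y < fst w \<longrightarrow> c \<le> G (reflect y w)"
      by (intro *) simp }
  { assume "c < r t"
    from right_of_y[OF t this] show "\<exists>d>0. \<forall>w\<in>ball (y, t) d. fst w < y \<longrightarrow> c \<le> G (reflect y w)"
      by (intro *) simp }
qed (use B_nonneg H_bounded cont at_y in \<open>auto intro: supersolution_reflect super lsc_on_reflect lsc\<close>)

text \<open>As \<open>H\<close> is at most \<open>C\<close>, a barrier that descends at speed \<open>C\<close> is a subsolution whatever its shape in
space. So on the strip of width \<open>2\<close> around \<open>x\<close> it may be a downward parabola with \<open>K\<close> so large
that it is below \<open>G\<close> on both sides of the strip, where nothing but a lower bound on a compact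
set is known. Replacing \<open>A\<close> by \<open>A + B\<close> absorbs the variation of the initial bound over the strip.\<close>

lemma linear_growth:
  assumes t: "0 \<le> t"
  shows "- (A + B + C * t) - B * \<bar>x - y\<bar> \<le> G (x, t)"
proof -
  define R where "R = {x - 1..x + 1} \<times> {0..t + 1}"
  have R: "compact R" "R \<noteq> {}" "lsc_on R G"
    using t by (auto simp: R_def compact_Times intro: lsc_on_subset[OF lsc])
  obtain z where z: "\<forall>w\<in>R. G z \<le> G w" using lsc_on_attains_min[OF R] by auto
  define c where "c = - A - B - B * \<bar>x - y\<bar>"
  define K where "K = max 0 (c - G z)"
  define g where "g = (\<lambda>\<xi>. c - K * (\<xi> - x)^2)"
  have K: "0 \<le> K" "c - K \<le> G z" by (auto simp: K_def)
  have C: "0 \<le> C" using H_bounded[of 0] by simp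
  have edge: "g \<xi> - C * (t' - 0) \<le> G (\<xi>, t')" if "\<bar>\<xi> - x\<bar> = 1" "0 < t'" "t' < t + 1" for \<xi> t'
  proof -
    have "(\<xi> - x)^2 = 1" using that(1) by (metis power2_abs power_one)
    then have "g \<xi> = c - K" by (simp add: g_def)
    moreover have "G z \<le> G (\<xi>, t')" using z that by (auto simp: R_def abs_if split: if_splits)
    moreover have "0 \<le> C * t'" using C that by simp
    ultimately show ?thesis using K by simp
  qed
  have "g x - C * (t - 0) \<le> G (x, t)"
  proof (rule rectangle_comparison[where T = "t + 1" and \<alpha> = "x - 1" and \<beta> = "x + 1" and g' = "\<lambda>\<xi>. - 2 * K * (\<xi> - x)"])
    show "(g has_real_derivative - 2 * K * (\<xi> - x)) (at \<xi>)" for \<xi>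
      unfolding g_def by (auto intro!: derivative_eq_intros)
    show "H (- 2 * K * (\<xi> - x)) \<le> C" for \<xi> using H_bounded[of "- 2 * K * (\<xi> - x)"] by linarith
    show "g \<xi> \<le> G (\<xi>, 0)" if "\<xi> \<in> {x - 1..x + 1}" for \<xi>
    proof -
      have "\<bar>\<xi> - y\<bar> \<le> \<bar>x - y\<bar> + 1" using that by auto
      then have "B * \<bar>\<xi> - y\<bar> \<le> B * (\<bar>x - y\<bar> + 1)" using B_nonneg by (intro mult_left_mono)
      moreover have "g \<xi> \<le> c" using K by (simp add: g_def)
      ultimately show ?thesis using initial[of \<xi>] by (simp add: c_def algebra_simps)
    qed
  qed (use edge t super lsc in \<open>auto intro!: continuous_intros\<close>)
  then show ?thesis by (simp add: g_def c_def)
qed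

text \<open>The affine function of slope \<open>a\<close> and speed \<open>- H a\<close> solves the equation and is compared with \<open>G\<close> on
the left of the line. Far to the left it is below \<open>G\<close>, since its slope exceeds the growth rate \<open>B\<close>;
on the line there is nothing to check as long as the jump is positive.\<close>

lemma left_trace_lower_bound:
  assumes s: "0 \<le> s" "s < T" and jump: "\<And>t. s < t \<Longrightarrow> t < T \<Longrightarrow> l t < r t"
    and a: "B < a" and line: "\<And>x. x \<le> y \<Longrightarrow> m + a * (x - y) \<le> G (x, s)"
    and t: "s \<le> t" "t < T"
  shows "m - H a * (t - s) \<le> l t"
proof -
  have C: "0 \<le> C" using H_bounded[of 0] by simp
  define D where "D = A + B + C * T"
  \<comment> \<open>The distance to the left at which linear growth alone puts the affine function below \<open>G\<close>.\<close>
  define q where "q = \<bar>m + C * T + D\<bar> / (a - B)"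
  have q: "0 \<le> q" "m + C * T + D \<le> (a - B) * q" using a by (auto simp: q_def)
  have "m + a * (y - y) - H a * (t - s) \<le> G (y, t)"
  proof (rule rectangle_comparison[where T = T and \<alpha> = "y - q" and \<beta> = y and g = "\<lambda>x. m + a * (x - y)" and g' = "\<lambda>_. a"])
    show "((\<lambda>x. m + a * (x - y)) has_real_derivative a) (at x)" for x
      by (auto intro!: derivative_eq_intros)
    fix u assume u: "s < u" "u < T"
    show "m + a * (y - q - y) - H a * (u - s) \<le> G (y - q, u)"
    proof -
      have "- H a * (u - s) \<le> C * (u - s)" using H_bounded[of a] u by (intro mult_right_mono) auto
      also have "\<dots> \<le> C * T" using C u s by (intro mult_left_mono) auto
      finally have 1: "- H a * (u - s) \<le> C * T" .
      have "C * u \<le> C * T" using C u by (intro mult_left_mono) auto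
      then have "- D - B * q \<le> G (y - q, u)"
        using linear_growth[of u "y - q"] q(1) u s by (simp add: D_def)
      then show ?thesis using 1 q(2) by (simp add: algebra_simps)
    qed
    have "G (y, u) = l u" using at_y[of u] jump[OF u] u s by simp
    then have "\<exists>c>G (y, u). \<exists>d>0. \<forall>w\<in>ball (y, u) d. y < fst w \<longrightarrow> c \<le> G w"
      using right_of_y[of u "(l u + r u) / 2"] jump[OF u] u s
      by (intro exI[of _ "(l u + r u) / 2"]) auto
    then show "m + a * (y - y) - H a * (u - s) \<le> G (y, u) \<or>
       (\<exists>c>G (y, u). \<exists>d>0. \<forall>w\<in>ball (y, u) d. y < fst w \<longrightarrow> c \<le> G w)" ..
  qed (use line s t super lsc q in \<open>auto\<close>)
  then show ?thesis using at_y[of t] s t by simp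
qed

text \<open>Semicontinuity gives the bound near \<open>y\<close>, and at a distance of at least \<open>d\<close> a large slope beats the
linear growth. As every slope beyond a threshold will do, one slope can be chosen for both the
lower and the upper envelope.\<close>

lemma steep_line_below:
  assumes s: "0 \<le> s" and \<epsilon>: "0 < \<epsilon>"
  obtains a0 where "B < a0"
    "\<And>a x. a0 \<le> a \<Longrightarrow> x \<le> y \<Longrightarrow> G (y, s) - \<epsilon> + a * (x - y) \<le> G (x, s)"
proof -
  obtain d where d: "d > 0" "\<And>w. w \<in> UNIV \<times> {0..} \<Longrightarrow> w \<in> ball (y, s) d \<Longrightarrow> G (y, s) - \<epsilon> < G w"
    using lsc[unfolded lsc_on_def, rule_format, of "(y, s)" "G (y, s) - \<epsilon>"] s \<epsilon> by auto
  define E where "E = \<bar>G (y, s) + A + B + C * s\<bar>"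
  define a0 where "a0 = B + 1 + E / d"
  have E: "0 \<le> E / d" using d by (simp add: E_def)
  have "G (y, s) - \<epsilon> + a * (x - y) \<le> G (x, s)" if a: "a0 \<le> a" and x: "x \<le> y" for a x
  proof (cases "y - x < d")
    case True
    then have "G (y, s) - \<epsilon> < G (x, s)" using d(2)[of "(x, s)"] s x by (simp add: dist_Pair_Pair dist_real_def)
    moreover have "a * (x - y) \<le> 0" using a x E B_nonneg by (intro mult_nonneg_nonpos) (auto simp: a0_def)
    ultimately show ?thesis by simp
  next
    case False
    have "E = E / d * d" using d by simp
    also have "\<dots> \<le> E / d * (y - x)" using False E by (intro mult_left_mono) auto
    also have "\<dots> \<le> (a - B) * (y - x)" using a x by (intro mult_right_mono) (auto simp: a0_def)
    finally have "E \<le> (a - B) * (y - x)" .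
    moreover have "\<bar>x - y\<bar> = y - x" using x by simp
    ultimately show ?thesis using linear_growth[OF s, of x] \<epsilon> by (simp add: E_def algebra_simps)
  qed
  then show ?thesis using that[of a0] E by (auto simp: a0_def)
qed

end

section \<open>Evolution of the jump\<close>

text \<open>Let \<open>u\<close> be the last zero of the jump before it becomes positive. After \<open>u\<close> both traces are controlled
by affine functions with the same large slope \<open>a\<close>: up to \<open>\<epsilon>\<close>, the left one is at least
\<open>l u - H a (v - u)\<close> and the right one is at most \<open>r u - H a (v - u)\<close>. The speeds cancel, so the
jump at time \<open>v\<close> is at most \<open>2 \<epsilon>\<close>.\<close>

lemma no_upward_jump_created:
  assumes lower: "supersolution_at_jump H G y l r A B C"
    and upper: "supersolution_at_jump (\<lambda>\<xi>. - H \<xi>) G' y (\<lambda>t. - r t) (\<lambda>t. - l t) A B C"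
    and s: "0 \<le> s" "s \<le> t" and le: "r s \<le> l s"
  shows "r t \<le> l t"
proof (rule ccontr)
  interpret L: supersolution_at_jump H G y l r A B C by (rule lower)
  interpret U: supersolution_at_jump "\<lambda>\<xi>. - H \<xi>" G' y "\<lambda>t. - r t" "\<lambda>t. - l t" A B C by (rule upper)
  assume "\<not> r t \<le> l t"
  then have gt: "l t < r t" by simp
  define f where "f = (\<lambda>u. r u - l u)"
  have fc: "continuous_on {0..} f" unfolding f_def by (intro continuous_intros L.cont)
  define S where "S = {s..t} \<inter> f -` {..0}"
  have "closed S" unfolding S_def
    by (rule continuous_closed_preimage) (use s in \<open>auto intro: continuous_on_subset[OF fc]\<close>)
  moreover have "bounded S" by (rule bounded_subset[of "{s..t}"]) (auto simp: S_def)
  ultimately have "compact S" by (simp add: compact_eq_bounded_closed)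
  moreover have "s \<in> S" using s le by (auto simp: S_def f_def)
  ultimately obtain u where u: "u \<in> S" "\<And>v. v \<in> S \<Longrightarrow> v \<le> u"
    using compact_attains_sup[of S] by blast
  have ust: "s \<le> u" "u < t" and fu: "f u \<le> 0"
    using u(1) gt by (auto simp: S_def f_def less_le)
  have jump: "l v < r v" if "u < v" "v \<le> t" for v
    using u(2)[of v] that ust by (auto simp: S_def f_def not_le[symmetric])
  obtain v where v: "u \<le> v" "v \<le> t" "f v = 0"
    using IVT'[of f u 0 t, OF fu] gt ust s continuous_on_subset[OF fc, of "{u..t}"]
    by (auto simp: f_def)
  then have "v = u" using u(2)[of v] ust by (auto simp: S_def)
  then have eq: "r u = l u" using v(3) by (simp add: f_def)
  define v where "v = (u + t) / 2"
  have v: "u < v" "v < t" using ust by (auto simp: v_def)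
  define \<epsilon> where "\<epsilon> = (r v - l v) / 3"
  have \<epsilon>: "0 < \<epsilon>" using jump[of v] v by (simp add: \<epsilon>_def)
  have u0: "0 \<le> u" using ust s by simp
  obtain a1 where a1: "B < a1"
    "\<And>a x. a1 \<le> a \<Longrightarrow> x \<le> y \<Longrightarrow> G (y, u) - \<epsilon> + a * (x - y) \<le> G (x, u)"
    by (rule L.steep_line_below[OF u0 \<epsilon>]) blast
  obtain a2 where a2: "B < a2"
    "\<And>a x. a2 \<le> a \<Longrightarrow> x \<le> y \<Longrightarrow> G' (y, u) - \<epsilon> + a * (x - y) \<le> G' (x, u)"
    by (rule U.steep_line_below[OF u0 \<epsilon>]) blast
  define a where "a = max a1 a2"
  have "G (y, u) - \<epsilon> - H a * (v - u) \<le> l v"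
    by (rule L.left_trace_lower_bound[where T = t and a = a]) (use a1 v u0 jump in \<open>auto simp: a_def\<close>)
  moreover have "G' (y, u) - \<epsilon> - (- H a) * (v - u) \<le> - r v"
    by (rule U.left_trace_lower_bound[where T = t and a = a]) (use a1 a2 v u0 jump in \<open>auto simp: a_def\<close>)
  ultimately have "r v - l v \<le> 2 * \<epsilon>" using L.at_y[OF u0] U.at_y[OF u0] eq by simp
  then show False using \<epsilon> by (simp add: \<epsilon>_def)
qed

text \<open>While the jump is positive, the left trace is above \<open>- A - H a t\<close> and the right trace is below
\<open>A - H b t\<close>. So the jump is at most \<open>2 A - (H b - H a) t\<close>.\<close>

lemma upward_jump_closes:
  assumes lower: "supersolution_at_jump H G y l r A B C"
    and upper: "supersolution_at_jump (\<lambda>\<xi>. - H \<xi>) G' y (\<lambda>t. - r t) (\<lambda>t. - l t) A B C"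
    and ab: "B < a" "B < b" "H a < H b"
  shows "\<exists>t>0. r t \<le> l t"
proof (rule ccontr)
  interpret L: supersolution_at_jump H G y l r A B C by (rule lower)
  interpret U: supersolution_at_jump "\<lambda>\<xi>. - H \<xi>" G' y "\<lambda>t. - r t" "\<lambda>t. - l t" A B C by (rule upper)
  assume "\<not> ?thesis"
  then have jump: "\<And>t. 0 < t \<Longrightarrow> l t < r t" by (auto simp: not_le)
  define t where "t = (2 * \<bar>A\<bar> + 1) / (H b - H a)"
  have t: "0 < t" "(H b - H a) * t = 2 * \<bar>A\<bar> + 1" using ab by (auto simp: t_def)
  have line: "- A + c * (x - y) \<le> - A - B * \<bar>x - y\<bar>" if "B < c" "x \<le> y" for c x
    using mult_right_mono[of B c "y - x"] that by (simp add: algebra_simps)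
  have "- A - H a * (t - 0) \<le> l t"
    by (rule L.left_trace_lower_bound[where T = "t + 1" and a = a])
      (use t ab jump line order_trans[OF line L.initial] in auto)
  moreover have "- A - (- H b) * (t - 0) \<le> - r t"
    by (rule U.left_trace_lower_bound[where T = "t + 1" and a = b])
      (use t ab jump line order_trans[OF line U.initial] in auto)
  ultimately have "r t - l t \<le> 2 * A - (H b - H a) * t" by (simp add: algebra_simps)
  then show False using t jump[OF t(1)] by (simp add: abs_if split: if_splits)
qed

text \<open>After the jump has closed, it can neither become positive nor, by reflection, negative.\<close>

theorem upward_jump_closes_for_good:
  assumes lower: "supersolution_at_jump H G y l r A B C"
    and upper: "supersolution_at_jump (\<lambda>\<xi>. - H \<xi>) G' y (\<lambda>t. - r t) (\<lambda>t. - l t) A B C"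
    and start: "l 0 \<le> r 0"
    and H: "\<not> H constant_on {B<..}"
  shows "\<exists>s\<ge>0. \<forall>t\<ge>s. l t = r t"
proof -
  interpret L: supersolution_at_jump H G y l r A B C by (rule lower)
  interpret U: supersolution_at_jump "\<lambda>\<xi>. - H \<xi>" G' y "\<lambda>t. - r t" "\<lambda>t. - l t" A B C by (rule upper)
  obtain a b where ab: "B < a" "B < b" "H a \<noteq> H b"
    using H unfolding constant_on_def by (metis greaterThan_iff gt_ex)
  then obtain t0 where t0: "0 < t0" "r t0 \<le> l t0"
    using upward_jump_closes[OF lower upper, of a b] upward_jump_closes[OF lower upper, of b a]
    by (meson linorder_neqE)
  have "continuous_on {0..t0} (\<lambda>t. l t - r t)"
    by (intro continuous_intros continuous_on_subset[OF L.cont(1)] continuous_on_subset[OF L.cont(2)]) auto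
  then obtain s where s: "0 \<le> s" "l s = r s"
    using IVT'[of "\<lambda>t. l t - r t" 0 0 t0] start t0 by auto
  have "l t = r t" if "s \<le> t" for t
  proof (rule antisym)
    show "r t \<le> l t"
      using no_upward_jump_created[OF lower upper s(1) that] s(2) by simp
    show "l t \<le> r t"
      using no_upward_jump_created[OF L.reflected U.reflected s(1) that] s(2) by simp
  qed
  then show ?thesis using s(1) by blast
qed

section \<open>Essential envelopes\<close>

lemma AE_on_open_witness:
  fixes S :: "'a::euclidean_space set"
  assumes "open S" "S \<noteq> {}" "AE w in lebesgue. w \<in> S \<longrightarrow> P w"
  obtains w where "w \<in> S" "P w"
proof -
  have "\<exists>w\<in>S. P w"
  proof (rule ccontr)
    assume "\<not> ?thesis"
    then have "AE w in lebesgue. w \<notin> S" using assms(3) by (auto elim: eventually_mono)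
    then have "negligible S"
      using assms(1) by (simp add: negligible_iff_null_sets null_sets_def AE_iff_null_sets[symmetric] AE_iff_measurable)
    then show False using open_not_negligible assms by blast
  qed
  then show ?thesis using that by blast
qed

lemma AE_lebesgue_on_iff:
  "S \<in> sets lebesgue \<Longrightarrow> (AE w in lebesgue_on S. P w) \<longleftrightarrow> (AE w in lebesgue. w \<in> S \<longrightarrow> P w)"
  by (simp add: AE_restrict_space_iff)

text \<open>The essential supremum over a ball is monotone in the radius, so that the limit in the definition of
the envelopes exists; it is finite because \<open>g\<close> is locally bounded and the balls around a point of
the closure meet \<open>S\<close> in a set of positive measure. The last two clauses characterise the limit by
inequalities almost everywhere.\<close>

lemma esssup_ball_tendsto:
  fixes S :: "'a::euclidean_space set"
  assumes S: "open S" "z \<in> closure S" and g: "Linf_loc (closure S) g"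
  obtains L where
    "((\<lambda>\<delta>. esssup (lebesgue_on (ball z \<delta> \<inter> S)) (\<lambda>w. ereal (g w))) \<longlongrightarrow> ereal L) (at_right 0)"
    "\<And>c \<delta>. 0 < \<delta> \<Longrightarrow> AE w in lebesgue. w \<in> ball z \<delta> \<inter> S \<longrightarrow> g w \<le> c \<Longrightarrow> L \<le> c"
    "\<And>c. L < c \<Longrightarrow> \<exists>\<delta>>0. AE w in lebesgue. w \<in> ball z \<delta> \<inter> S \<longrightarrow> g w \<le> c"
proof -
  define E where "E \<delta> = esssup (lebesgue_on (ball z \<delta> \<inter> S)) (\<lambda>w. ereal (g w))" for \<delta>
  define K where "K \<delta> = cball z \<delta> \<inter> closure S" for \<delta>
  have K: "compact (K \<delta>)" "K \<delta> \<subseteq> closure S" for \<delta> by (auto simp: K_def intro: closed_Int_compact compact_Int_closed)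
  have sub: "ball z \<delta> \<inter> S \<subseteq> K \<delta>" for \<delta> using closure_subset[of S] by (auto simp: K_def)
  have ms: "ball z \<delta> \<inter> S \<in> sets lebesgue" for \<delta> using S by (auto intro!: borel_open)
  have meas: "(\<lambda>w. ereal (g w)) \<in> borel_measurable (lebesgue_on (ball z \<delta> \<inter> S))" for \<delta>
  proof -
    have "g \<in> borel_measurable (lebesgue_on (K \<delta>))" using g K unfolding Linf_loc_def Linf_def by blast
    then have "g \<in> borel_measurable (lebesgue_on (ball z \<delta> \<inter> S))"
      by (rule measurable_restrict_mono[OF _ sub])
    then show ?thesis by measurable
  qed
  have le_iff: "E \<delta> \<le> ereal c \<longleftrightarrow> (AE w in lebesgue. w \<in> ball z \<delta> \<inter> S \<longrightarrow> g w \<le> c)" for \<delta> c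
  proof
    assume *: "E \<delta> \<le> ereal c"
    have "AE w in lebesgue_on (ball z \<delta> \<inter> S). ereal (g w) \<le> E \<delta>" unfolding E_def by (rule esssup_AE)
    then have "AE w in lebesgue_on (ball z \<delta> \<inter> S). g w \<le> c"
      using * by (auto elim!: eventually_mono dest: order_trans)
    then show "AE w in lebesgue. w \<in> ball z \<delta> \<inter> S \<longrightarrow> g w \<le> c"
      unfolding AE_lebesgue_on_iff[OF ms] .
  next
    assume "AE w in lebesgue. w \<in> ball z \<delta> \<inter> S \<longrightarrow> g w \<le> c"
    then have "AE w in lebesgue_on (ball z \<delta> \<inter> S). g w \<le> c" unfolding AE_lebesgue_on_iff[OF ms] .
    then show "E \<delta> \<le> ereal c" unfolding E_def by (intro esssup_I meas) auto
  qed
  have mono: "E \<delta>1 \<le> E \<delta>2" if "\<delta>1 \<le> \<delta>2" for \<delta>1 \<delta>2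
  proof (rule ereal_le_real)
    fix c assume "E \<delta>2 \<le> ereal c"
    then show "E \<delta>1 \<le> ereal c" unfolding le_iff using that by (auto elim!: eventually_mono)
  qed
  obtain C where "AE w in lebesgue_on (K 1). \<bar>g w\<bar> \<le> C"
    using g K unfolding Linf_loc_def Linf_def by blast
  moreover have "K 1 \<in> sets lebesgue" using lmeasurable_compact[OF K(1)] by (rule fmeasurableD)
  ultimately have C: "AE w in lebesgue. w \<in> K 1 \<longrightarrow> \<bar>g w\<bar> \<le> C" by (simp add: AE_lebesgue_on_iff)
  define L where "L = (INF \<delta>\<in>{0<..}. E \<delta>)"
  have up: "L \<le> ereal C"
  proof -
    have "E 1 \<le> ereal C" unfolding le_iff using C by (rule eventually_mono) (use sub[of 1] in auto)
    moreover have "L \<le> E 1" unfolding L_def by (rule INF_lower) simp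
    ultimately show ?thesis by simp
  qed
  have low: "ereal (- C) \<le> L" unfolding L_def
  proof (rule INF_greatest, rule ccontr)
    fix \<delta> :: real assume \<delta>: "\<delta> \<in> {0<..}" "\<not> ereal (- C) \<le> E \<delta>"
    then obtain c where c: "E \<delta> \<le> ereal c" "c < - C"
      by (metis ereal_dense2 ereal_less_eq(3) less_ereal.simps(1) less_imp_le not_le)
    then have "AE w in lebesgue. w \<in> ball z \<delta> \<inter> S \<longrightarrow> g w \<le> c" by (simp add: le_iff)
    with C have "AE w in lebesgue. w \<in> ball z (min 1 \<delta>) \<inter> S \<longrightarrow> False"
      by eventually_elim (use sub[of 1] c in auto)
    moreover have "ball z (min 1 \<delta>) \<inter> S \<noteq> {}" using S \<delta> 
      by (metis Int_commute closure_iff_nhds_not_empty ball_subset_cball centre_in_ball greaterThan_iff min_less_iff_conj open_ball subset_refl zero_less_one)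
    moreover have "open (ball z (min 1 \<delta>) \<inter> S)" using S by auto
    ultimately show False by (elim AE_on_open_witness) auto
  qed
  obtain L' where L': "L = ereal L'" using up low by (cases L) auto
  have lim: "(E \<longlongrightarrow> L) (at_right 0)"
  proof (rule order_tendstoI)
    fix a assume "a < L"
    then have "a < E \<delta>" if "0 < \<delta>" for \<delta> using that by (auto simp: L_def intro: less_le_trans INF_lower)
    then show "\<forall>\<^sub>F \<delta> in at_right 0. a < E \<delta>" by (auto simp: eventually_at_right_field intro: exI[of _ 1])
  next
    fix a assume "L < a"
    then obtain \<delta> where "0 < \<delta>" "E \<delta> < a" by (auto simp: L_def INF_less_iff)
    then show "\<forall>\<^sub>F \<delta> in at_right 0. E \<delta> < a"
      unfolding eventually_at_right_field by (metis mono le_less_trans less_imp_le)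
  qed
  show ?thesis
  proof (rule that)
    show "((\<lambda>\<delta>. esssup (lebesgue_on (ball z \<delta> \<inter> S)) (\<lambda>w. ereal (g w))) \<longlongrightarrow> ereal L') (at_right 0)"
      using lim by (simp add: E_def[abs_def] L')
    show "L' \<le> c" if "0 < \<delta>" "AE w in lebesgue. w \<in> ball z \<delta> \<inter> S \<longrightarrow> g w \<le> c" for c \<delta>
    proof -
      have "L \<le> E \<delta>" unfolding L_def using that by (intro INF_lower) auto
      also have "E \<delta> \<le> ereal c" unfolding le_iff by (rule that(2))
      finally show ?thesis by (simp add: L')
    qed
    show "\<exists>\<delta>>0. AE w in lebesgue. w \<in> ball z \<delta> \<inter> S \<longrightarrow> g w \<le> c" if "L' < c" for c
    proof -
      have "L < ereal c" using that by (simp add: L')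
      then obtain \<delta> where "0 < \<delta>" "E \<delta> < ereal c" by (auto simp: L_def INF_less_iff)
      then show ?thesis using le_iff by (meson less_imp_le)
    qed
  qed
qed

lemma Linf_loc_uminus: "Linf_loc S g \<Longrightarrow> Linf_loc S (\<lambda>w. - g w)"
  unfolding Linf_loc_def Linf_def by simp

lemma lower_env_ge:
  fixes S :: "'a::euclidean_space set"
  assumes S: "open S" "z \<in> closure S" and g: "Linf_loc (closure S) g"
    and "0 < \<delta>" "AE w in lebesgue. w \<in> ball z \<delta> \<inter> S \<longrightarrow> c \<le> g w"
  shows "c \<le> lower_env S g z"
proof -
  obtain L where L: "((\<lambda>\<delta>. esssup (lebesgue_on (ball z \<delta> \<inter> S)) (\<lambda>w. ereal (- g w))) \<longlongrightarrow> ereal L) (at_right 0)"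
    "\<And>c \<delta>. 0 < \<delta> \<Longrightarrow> AE w in lebesgue. w \<in> ball z \<delta> \<inter> S \<longrightarrow> - g w \<le> c \<Longrightarrow> L \<le> c"
    by (rule esssup_ball_tendsto[OF S Linf_loc_uminus[OF g]]) blast
  have "lower_env S g z = - L"
    unfolding lower_env_def using tendsto_Lim[OF _ tendsto_uminus_ereal[OF L(1)]] by simp
  then show ?thesis using L(2)[of \<delta> "- c"] assms(4,5) by simp
qed

lemma AE_ge_of_less_lower_env:
  fixes S :: "'a::euclidean_space set"
  assumes S: "open S" "z \<in> closure S" and g: "Linf_loc (closure S) g" and c: "c < lower_env S g z"
  shows "\<exists>\<delta>>0. AE w in lebesgue. w \<in> ball z \<delta> \<inter> S \<longrightarrow> c \<le> g w"
proof -
  obtain L where L: "((\<lambda>\<delta>. esssup (lebesgue_on (ball z \<delta> \<inter> S)) (\<lambda>w. ereal (- g w))) \<longlongrightarrow> ereal L) (at_right 0)"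
    "\<And>c. L < c \<Longrightarrow> \<exists>\<delta>>0. AE w in lebesgue. w \<in> ball z \<delta> \<inter> S \<longrightarrow> - g w \<le> c"
    by (rule esssup_ball_tendsto[OF S Linf_loc_uminus[OF g]]) blast
  have "lower_env S g z = - L"
    unfolding lower_env_def using tendsto_Lim[OF _ tendsto_uminus_ereal[OF L(1)]] by simp
  then show ?thesis using L(2)[of "- c"] c by simp
qed

text \<open>Existence of the limit is needed here: without it the value of \<open>Lim\<close> would be arbitrary and need not
change sign with the function.\<close>

lemma lower_env_uminus:
  fixes S :: "'a::euclidean_space set"
  assumes S: "open S" "z \<in> closure S" and g: "Linf_loc (closure S) g"
  shows "lower_env S (\<lambda>w. - g w) z = - upper_env S g z"
proof -
  obtain L where L: "((\<lambda>\<delta>. esssup (lebesgue_on (ball z \<delta> \<inter> S)) (\<lambda>w. ereal (g w))) \<longlongrightarrow> ereal L) (at_right 0)"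
    by (rule esssup_ball_tendsto[OF S g]) blast
  show ?thesis
    unfolding lower_env_def upper_env_def
    using tendsto_Lim[OF _ tendsto_uminus_ereal[OF L]] tendsto_Lim[OF _ L] by simp
qed

lemma lower_env_cong:
  assumes "0 < d" "ball z d \<inter> S = ball z d \<inter> S'"
  shows "lower_env S g z = lower_env S' g z"
proof -
  have "ball z \<delta> \<inter> S = ball z \<delta> \<inter> S'" if "\<delta> < d" for \<delta>
  proof -
    have "ball z \<delta> \<inter> X = ball z \<delta> \<inter> (ball z d \<inter> X)" for X using that by auto
    then show ?thesis using assms(2) by metis
  qed
  then have ev: "\<forall>\<^sub>F \<delta> in at_right 0. - esssup (lebesgue_on (ball z \<delta> \<inter> S)) (\<lambda>w. ereal (- g w)) =
     - esssup (lebesgue_on (ball z \<delta> \<inter> S')) (\<lambda>w. ereal (- g w))"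
    unfolding eventually_at_right_field using assms(1) by (intro exI[of _ d]) auto
  show ?thesis unfolding lower_env_def Topological_Spaces.Lim_def tendsto_cong[OF ev] ..
qed

lemma lsc_on_lower_env:
  fixes S :: "'a::euclidean_space set"
  assumes S: "open S" and g: "Linf_loc (closure S) g"
  shows "lsc_on (closure S) (lower_env S g)"
  unfolding lsc_on_def
proof (intro ballI allI impI)
  fix z c assume z: "z \<in> closure S" and c: "c < lower_env S g z"
  then obtain c' where c': "c < c'" "c' < lower_env S g z" using dense by blast
  obtain d where d: "d > 0" "AE w in lebesgue. w \<in> ball z d \<inter> S \<longrightarrow> c' \<le> g w"
    using AE_ge_of_less_lower_env[OF S z g c'(2)] by blast
  have "c < lower_env S g v" if v: "v \<in> closure S \<inter> ball z d" for v
  proof -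
    obtain e where e: "e > 0" "ball v e \<subseteq> ball z d"
      using v by (metis IntD2 open_ball open_contains_ball)
    have "AE w in lebesgue. w \<in> ball v e \<inter> S \<longrightarrow> c' \<le> g w"
      using d(2) by (rule eventually_mono) (use e in auto)
    then have "c' \<le> lower_env S g v" using v e by (intro lower_env_ge[OF S _ g]) auto
    then show ?thesis using c' by simp
  qed
  then show "\<exists>d>0. \<forall>w\<in>closure S \<inter> ball z d. c < lower_env S g w" using d(1) by blast
qed

text \<open>The set \<open>X\<close> may reach \<open>z\<close> from within \<open>S\<close> only, as happens at the initial time.\<close>

lemma lower_env_eq_continuous_representative:
  fixes S :: "'a::euclidean_space set"
  assumes S: "open S" "z \<in> closure S" and g: "Linf_loc (closure S) g"
    and V: "continuous_on X V" "z \<in> X" and d: "0 < d" "ball z d \<inter> S \<subseteq> X"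
    and eq: "AE w in lebesgue. w \<in> ball z d \<inter> S \<longrightarrow> g w = V w"
  shows "lower_env S g z = V z"
proof (rule antisym)
  show "V z \<le> lower_env S g z"
  proof (rule field_le_epsilon)
    fix \<epsilon> :: real assume "0 < \<epsilon>"
    then obtain e where e: "e > 0" "\<And>w. w \<in> X \<Longrightarrow> dist w z < e \<Longrightarrow> dist (V w) (V z) < \<epsilon>"
      using V unfolding continuous_on_iff by blast
    have "V z - \<epsilon> \<le> g w" if "w \<in> ball z (min d e) \<inter> S" "w \<in> ball z d \<inter> S \<longrightarrow> g w = V w" for w
    proof -
      have "w \<in> X" "dist w z < e" "g w = V w" using that d(2) by (auto simp: dist_commute)
      then show ?thesis using e(2)[of w] by (auto simp: dist_real_def)
    qed
    then have "AE w in lebesgue. w \<in> ball z (min d e) \<inter> S \<longrightarrow> V z - \<epsilon> \<le> g w"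
      using eq by (auto elim!: eventually_mono)
    from lower_env_ge[OF S g _ this] have "V z - \<epsilon> \<le> lower_env S g z" using d(1) e(1) by simp
    then show "V z \<le> lower_env S g z + \<epsilon>" by simp
  qed
  show "lower_env S g z \<le> V z"
  proof (rule ccontr)
    assume "\<not> ?thesis"
    then obtain c where c: "V z < c" "c < lower_env S g z" using dense by (meson not_le)
    obtain e1 where e1: "e1 > 0" "AE w in lebesgue. w \<in> ball z e1 \<inter> S \<longrightarrow> c \<le> g w"
      using AE_ge_of_less_lower_env[OF S g c(2)] by blast
    obtain e where e: "e > 0" "\<And>w. w \<in> X \<Longrightarrow> dist w z < e \<Longrightarrow> dist (V w) (V z) < c - V z"
      using V c unfolding continuous_on_iff by (meson diff_gt_0_iff_gt)
    define \<delta> where "\<delta> = min d (min e e1)"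
    have \<delta>: "0 < \<delta>" using d e e1 by (simp add: \<delta>_def)
    have "AE w in lebesgue. w \<in> ball z \<delta> \<inter> S \<longrightarrow> False"
      using eq e1(2)
    proof eventually_elim
      case (elim w)
      show ?case
      proof
        assume w: "w \<in> ball z \<delta> \<inter> S"
        then have "w \<in> X" "dist w z < e" "c \<le> V w" using elim d(2) by (auto simp: \<delta>_def dist_commute)
        then show False using e(2)[of w] by (auto simp: dist_real_def)
      qed
    qed
    moreover have "open (ball z \<delta> \<inter> S)" using S by auto
    moreover have "ball z \<delta> \<inter> S \<noteq> {}"
    proof -
      obtain v where "v \<in> S" "dist v z < \<delta>" using S(2) \<delta> unfolding closure_approachable by blast
      then have "v \<in> ball z \<delta> \<inter> S" by (simp add: dist_commute)
      then show ?thesis by blast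
    qed
    ultimately show False by (elim AE_on_open_witness) auto
  qed
qed

section \<open>The two envelopes of a viscosity solution\<close>

text \<open>The envelopes with respect to \<open>Q_domain T\<close> do not depend on \<open>T\<close> before time \<open>T\<close>. They are
therefore taken with respect to the whole upper half plane, which gives one function for all times.\<close>

abbreviation "upper_half \<equiv> (UNIV :: real set) \<times> {0::real<..}"

lemma closure_upper_half: "closure upper_half = UNIV \<times> {0..}"
  by (simp add: closure_Times)

lemma open_upper_half: "open upper_half"
  by (intro open_Times) auto

lemma closure_Q_domain: "0 < T \<Longrightarrow> closure (Q_domain T) = UNIV \<times> {0..T}"
  by (simp add: Q_domain_def closure_Times)

lemma Linf_loc_upper_half:
  assumes "\<And>T. 0 < T \<Longrightarrow> Linf_loc (closure (Q_domain T)) g"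
  shows "Linf_loc (closure upper_half) g"
  unfolding Linf_loc_def
proof (intro allI impI)
  fix K :: "(real \<times> real) set" assume K: "compact K \<and> K \<subseteq> closure upper_half"
  then have "bounded K" by (simp add: compact_imp_bounded)
  then obtain b where b: "0 < b" "\<And>z. z \<in> K \<Longrightarrow> norm z \<le> b"
    unfolding bounded_pos by auto
  have "K \<subseteq> closure (Q_domain b)"
    unfolding closure_Q_domain[OF b(1)]
  proof
    fix z assume z: "z \<in> K"
    then have "norm (snd z) \<le> b" using b(2)[of z] norm_snd_le[of "snd z" "fst z"] by simp
    then show "z \<in> UNIV \<times> {0..b}" using z K by (auto simp: closure_upper_half mem_Times_iff)
  qed
  then show "Linf K g" using assms[OF b(1)] K unfolding Linf_loc_def by blast
qed

lemma lower_env_Q_domain: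
  assumes "snd z < T"
  shows "lower_env (Q_domain T) g z = lower_env upper_half g z"
proof (rule lower_env_cong)
  show "0 < T - snd z" using assms by simp
  have "snd w < T" if "w \<in> ball z (T - snd z)" for w
    using that dist_snd_le[of z w] by (auto simp: dist_real_def)
  then show "ball z (T - snd z) \<inter> Q_domain T = ball z (T - snd z) \<inter> upper_half"
    by (auto simp: Q_domain_def)
qed

lemma supersolution_cong:
  assumes "\<And>z. z \<in> Q_domain T \<Longrightarrow> G z = G' z"
  shows "supersolution H T G = supersolution H T G'"
proof -
  have "local_min_in (Q_domain T) (\<lambda>w. G w - \<phi> w) z = local_min_in (Q_domain T) (\<lambda>w. G' w - \<phi> w) z" for \<phi> z
    unfolding local_min_in_def by (auto simp: assms)
  then show ?thesis by (simp add: supersolution_def)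
qed

lemma viscosity_solution_lower_env:
  assumes "viscosity_solution H T U"
  shows "supersolution H T (lower_env upper_half U)"
proof -
  have "supersolution H T (lower_env (Q_domain T) U)"
    using assms unfolding viscosity_solution_def supersolution_def by blast
  then show ?thesis
    by (subst supersolution_cong) (auto simp: Q_domain_def lower_env_Q_domain[symmetric])
qed

lemma viscosity_solution_lower_env_uminus:
  assumes "viscosity_solution H T U" "0 < T"
  shows "supersolution (\<lambda>\<xi>. - H (- \<xi>)) T (lower_env upper_half (\<lambda>w. - U w))"
proof -
  have U: "Linf_loc (closure (Q_domain T)) U" using assms(1) by (simp add: viscosity_solution_def)
  have Q: "open (Q_domain T)" unfolding Q_domain_def by (intro open_Times) auto
  have "supersolution (\<lambda>\<xi>. - H (- \<xi>)) T (\<lambda>z. - upper_env (Q_domain T) U z)"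
    unfolding supersolution_def
  proof (intro allI impI)
    fix \<phi> \<phi>x \<phi>t z
    assume C1: "C1_partials (Q_domain T) \<phi> \<phi>x \<phi>t"
      and lm: "local_min_in (Q_domain T) (\<lambda>w. - upper_env (Q_domain T) U w - \<phi> w) z"
    have "C1_partials (Q_domain T) (\<lambda>w. - \<phi> w) (\<lambda>w. - \<phi>x w) (\<lambda>w. - \<phi>t w)"
      unfolding C1_partials_def
    proof (intro conjI ballI)
      show "continuous_on (Q_domain T) (\<lambda>w. - \<phi>x w)" "continuous_on (Q_domain T) (\<lambda>w. - \<phi>t w)"
        using C1 by (auto simp: C1_partials_def intro!: continuous_intros)
      fix w assume "w \<in> Q_domain T"
      then have "(\<phi> has_derivative (\<lambda>(h, k). \<phi>x w * h + \<phi>t w * k)) (at w)"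
        using C1 by (auto simp: C1_partials_def)
      from has_derivative_minus[OF this]
      show "((\<lambda>w. - \<phi> w) has_derivative (\<lambda>(h, k). - \<phi>x w * h + - \<phi>t w * k)) (at w)"
        by (rule has_derivative_eq_rhs) (auto simp: fun_eq_iff)
    qed
    moreover have "local_max_in (Q_domain T) (\<lambda>w. upper_env (Q_domain T) U w - (- \<phi> w)) z"
      using lm unfolding local_min_in_def local_max_in_def by (simp add: algebra_simps)
    ultimately have "- \<phi>t z + H (- \<phi>x z) \<le> 0"
      using assms(1) unfolding viscosity_solution_def by blast
    then show "0 \<le> \<phi>t z + - H (- \<phi>x z)" by simp
  qed
  moreover have "lower_env upper_half (\<lambda>w. - U w) z = - upper_env (Q_domain T) U z" if z: "z \<in> Q_domain T" for z
  proof -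
    have "z \<in> closure (Q_domain T)" using z closure_subset by blast
    then show ?thesis using lower_env_uminus[OF Q _ U, of z] lower_env_Q_domain[of z T "\<lambda>w. - U w"] z
      by (auto simp: Q_domain_def)
  qed
  ultimately show ?thesis by (subst supersolution_cong) auto
qed

section \<open>Traces at a discontinuity\<close>

locale strip_representatives =
  fixes g :: "real \<times> real \<Rightarrow> real" and VL VR :: "real \<times> real \<Rightarrow> real" and y \<rho> :: real
  assumes \<rho>_pos: "0 < \<rho>"
    and loc: "Linf_loc (closure upper_half) g"
    and VL_cont: "continuous_on ({y - \<rho>..y} \<times> {0..}) VL"
    and VR_cont: "continuous_on ({y..y + \<rho>} \<times> {0..}) VR"
    and VL_eq: "AE w in lebesgue. w \<in> {y - \<rho><..<y} \<times> {0<..} \<longrightarrow> g w = VL w"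
    and VR_eq: "AE w in lebesgue. w \<in> {y<..<y + \<rho>} \<times> {0<..} \<longrightarrow> g w = VR w"
begin

lemma uminus: "strip_representatives (\<lambda>w. - g w) (\<lambda>w. - VL w) (\<lambda>w. - VR w) y \<rho>"
  by unfold_locales
    (use \<rho>_pos loc VL_cont VR_cont VL_eq VR_eq in
      \<open>auto intro: Linf_loc_uminus continuous_on_minus elim: eventually_mono\<close>)

lemma lower_env_left:
  assumes x: "y - \<rho> < x" "x < y" and t: "0 \<le> t"
  shows "lower_env upper_half g (x, t) = VL (x, t)"
proof (rule lower_env_eq_continuous_representative[OF open_upper_half _ loc VL_cont])
  define d where "d = min (x - (y - \<rho>)) (y - x)"
  have *: "y - \<rho> < fst w \<and> fst w < y" if "w \<in> ball (x, t) d" for w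
    using that dist_fst_le[of "(x, t)" w] by (auto simp: d_def dist_real_def)
  then show "ball (x, t) d \<inter> upper_half \<subseteq> {y - \<rho>..y} \<times> {0..}" by (force simp: mem_Times_iff)
  show "AE w in lebesgue. w \<in> ball (x, t) d \<inter> upper_half \<longrightarrow> g w = VL w"
    using VL_eq by (rule eventually_mono) (use * in \<open>auto simp: mem_Times_iff\<close>)
  show "0 < d" using x by (simp add: d_def)
qed (use x t in \<open>auto simp: closure_upper_half\<close>)

lemma lower_env_right:
  assumes x: "y < x" "x < y + \<rho>" and t: "0 \<le> t"
  shows "lower_env upper_half g (x, t) = VR (x, t)"
proof (rule lower_env_eq_continuous_representative[OF open_upper_half _ loc VR_cont])
  define d where "d = min (x - y) (y + \<rho> - x)"
  have *: "y < fst w \<and> fst w < y + \<rho>" if "w \<in> ball (x, t) d" for w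
    using that dist_fst_le[of "(x, t)" w] by (auto simp: d_def dist_real_def)
  then show "ball (x, t) d \<inter> upper_half \<subseteq> {y..y + \<rho>} \<times> {0..}" by (force simp: mem_Times_iff)
  show "AE w in lebesgue. w \<in> ball (x, t) d \<inter> upper_half \<longrightarrow> g w = VR w"
    using VR_eq by (rule eventually_mono) (use * in \<open>auto simp: mem_Times_iff\<close>)
  show "0 < d" using x by (simp add: d_def)
qed (use x t in \<open>auto simp: closure_upper_half\<close>)

lemma near_left:
  assumes t: "0 \<le> t" and c: "c < VL (y, t)"
  obtains d where "0 < d" "\<And>w. w \<in> ball (y, t) d \<Longrightarrow> fst w \<le> y \<Longrightarrow> 0 \<le> snd w \<Longrightarrow> y - \<rho> < fst w \<and> c < VL w"
proof -
  have "(y, t) \<in> {y - \<rho>..y} \<times> {0..}" using \<rho>_pos t by auto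
  then obtain e where e: "e > 0"
    "\<And>w. w \<in> {y - \<rho>..y} \<times> {0..} \<Longrightarrow> dist w (y, t) < e \<Longrightarrow> dist (VL w) (VL (y, t)) < VL (y, t) - c"
    using VL_cont c unfolding continuous_on_iff by (meson diff_gt_0_iff_gt)
  show ?thesis
  proof (rule that[of "min e \<rho>"])
    fix w :: "real \<times> real" assume w: "w \<in> ball (y, t) (min e \<rho>)" "fst w \<le> y" "0 \<le> snd w"
    then have "y - \<rho> < fst w" using dist_fst_le[of "(y, t)" w] by (auto simp: dist_real_def)
    moreover from this have "dist (VL w) (VL (y, t)) < VL (y, t) - c"
      using e(2)[of w] w by (auto simp: mem_Times_iff dist_commute)
    ultimately show "y - \<rho> < fst w \<and> c < VL w" by (auto simp: dist_real_def)
  qed (use e \<rho>_pos in auto)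
qed

lemma near_right:
  assumes t: "0 \<le> t" and c: "c < VR (y, t)"
  obtains d where "0 < d" "\<And>w. w \<in> ball (y, t) d \<Longrightarrow> y \<le> fst w \<Longrightarrow> 0 \<le> snd w \<Longrightarrow> fst w < y + \<rho> \<and> c < VR w"
proof -
  have "(y, t) \<in> {y..y + \<rho>} \<times> {0..}" using \<rho>_pos t by auto
  then obtain e where e: "e > 0"
    "\<And>w. w \<in> {y..y + \<rho>} \<times> {0..} \<Longrightarrow> dist w (y, t) < e \<Longrightarrow> dist (VR w) (VR (y, t)) < VR (y, t) - c"
    using VR_cont c unfolding continuous_on_iff by (meson diff_gt_0_iff_gt)
  show ?thesis
  proof (rule that[of "min e \<rho>"])
    fix w :: "real \<times> real" assume w: "w \<in> ball (y, t) (min e \<rho>)" "y \<le> fst w" "0 \<le> snd w"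
    then have "fst w < y + \<rho>" using dist_fst_le[of "(y, t)" w] by (auto simp: dist_real_def)
    moreover from this have "dist (VR w) (VR (y, t)) < VR (y, t) - c"
      using e(2)[of w] w by (auto simp: mem_Times_iff dist_commute)
    ultimately show "fst w < y + \<rho> \<and> c < VR w" by (auto simp: dist_real_def)
  qed (use e \<rho>_pos in auto)
qed

lemma traces_continuous:
  "continuous_on {0..} (\<lambda>t. VL (y, t))" "continuous_on {0..} (\<lambda>t. VR (y, t))"
  by (rule continuous_on_compose2[OF VL_cont] continuous_on_compose2[OF VR_cont];
      use \<rho>_pos in \<open>auto intro!: continuous_intros\<close>)+

lemma lower_env_limits:
  assumes t: "0 \<le> t"
  shows "((\<lambda>x. lower_env upper_half g (x, t)) \<longlongrightarrow> VL (y, t)) (at_left y)"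
    and "((\<lambda>x. lower_env upper_half g (x, t)) \<longlongrightarrow> VR (y, t)) (at_right y)"
proof -
  have "continuous_on {y - \<rho>..y} (\<lambda>x. VL (x, t))" "continuous_on {y..y + \<rho>} (\<lambda>x. VR (x, t))"
    by (rule continuous_on_compose2[OF VL_cont] continuous_on_compose2[OF VR_cont];
        use t in \<open>auto intro!: continuous_intros\<close>)+
  then have L: "((\<lambda>x. VL (x, t)) \<longlongrightarrow> VL (y, t)) (at_left y)"
    and R: "((\<lambda>x. VR (x, t)) \<longlongrightarrow> VR (y, t)) (at_right y)"
    using \<rho>_pos continuous_on_Icc_at_leftD[of "y - \<rho>" y "\<lambda>x. VL (x, t)"]
      continuous_on_Icc_at_rightD[of y "y + \<rho>" "\<lambda>x. VR (x, t)"] by auto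
  have "\<forall>\<^sub>F x in at_left y. VL (x, t) = lower_env upper_half g (x, t)"
    unfolding eventually_at_left_field using lower_env_left[OF _ _ t] \<rho>_pos
    by (intro exI[of _ "y - \<rho>"]) auto
  then show "((\<lambda>x. lower_env upper_half g (x, t)) \<longlongrightarrow> VL (y, t)) (at_left y)"
    by (rule Lim_transform_eventually[OF L])
  have "\<forall>\<^sub>F x in at_right y. VR (x, t) = lower_env upper_half g (x, t)"
    unfolding eventually_at_right_field using lower_env_right[OF _ _ t] \<rho>_pos
    by (intro exI[of _ "y + \<rho>"]) auto
  then show "((\<lambda>x. lower_env upper_half g (x, t)) \<longlongrightarrow> VR (y, t)) (at_right y)"
    by (rule Lim_transform_eventually[OF R])
qed

lemma AE_off_line: "AE w in lebesgue. fst (w :: real \<times> real) \<noteq> y"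
proof -
  have "negligible {w :: real \<times> real. (1, 0) \<bullet> w = y}" by (rule negligible_hyperplane) (auto simp: prod_eq_iff)
  then have "{w :: real \<times> real. fst w = y} \<in> null_sets lebesgue"
    by (simp add: negligible_iff_null_sets inner_prod_def)
  then show ?thesis by (rule AE_I') auto
qed

text \<open>The minimum of the traces is a lower bound since the line is a null set; it is attained because the
envelope is lower semicontinuous and agrees with the representatives off the line.\<close>

lemma lower_env_at_jump:
  assumes t: "0 \<le> t"
  shows "lower_env upper_half g (y, t) = min (VL (y, t)) (VR (y, t))"
proof (rule antisym)
  have cl: "(y, t) \<in> closure upper_half" using t by (simp add: closure_upper_half)
  show "min (VL (y, t)) (VR (y, t)) \<le> lower_env upper_half g (y, t)"
  proof (rule dense_le)
    fix c assume "c < min (VL (y, t)) (VR (y, t))"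
    then have c: "c < VL (y, t)" "c < VR (y, t)" by auto
    obtain d1 where d1: "0 < d1" "\<And>w. w \<in> ball (y, t) d1 \<Longrightarrow> fst w \<le> y \<Longrightarrow> 0 \<le> snd w \<Longrightarrow> y - \<rho> < fst w \<and> c < VL w"
      by (rule near_left[OF t c(1)]) blast
    obtain d2 where d2: "0 < d2" "\<And>w. w \<in> ball (y, t) d2 \<Longrightarrow> y \<le> fst w \<Longrightarrow> 0 \<le> snd w \<Longrightarrow> fst w < y + \<rho> \<and> c < VR w"
      by (rule near_right[OF t c(2)]) blast
    have "AE w in lebesgue. w \<in> ball (y, t) (min d1 d2) \<inter> upper_half \<longrightarrow> c \<le> g w"
      using AE_off_line VL_eq VR_eq
    proof eventually_elim
      case (elim w)
      show ?case
      proof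
        assume w: "w \<in> ball (y, t) (min d1 d2) \<inter> upper_half"
        then have w': "w \<in> ball (y, t) d1" "w \<in> ball (y, t) d2" "0 < snd w" by auto
        show "c \<le> g w"
        proof (cases "fst w < y")
          case True
          then show ?thesis using d1(2)[of w] w' elim(2) by (auto simp: mem_Times_iff)
        next
          case False
          then have "y < fst w" using elim(1) by simp
          then show ?thesis using d2(2)[of w] w' elim(3) by (auto simp: mem_Times_iff)
        qed
      qed
    qed
    from lower_env_ge[OF open_upper_half cl loc _ this]
    show "c \<le> lower_env upper_half g (y, t)" using d1(1) d2(1) by simp
  qed
  show "lower_env upper_half g (y, t) \<le> min (VL (y, t)) (VR (y, t))"
  proof (rule dense_le)
    fix c assume "c < lower_env upper_half g (y, t)"
    then obtain d where d: "d > 0" "\<And>w. w \<in> closure upper_half \<Longrightarrow> w \<in> ball (y, t) d \<Longrightarrow> c < lower_env upper_half g w"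
      using lsc_on_lower_env[OF open_upper_half loc] cl unfolding lsc_on_def by (meson IntI)
    have near: "c \<le> lower_env upper_half g (x, t)" if "\<bar>x - y\<bar> < d" for x
      using d(2)[of "(x, t)"] that t by (simp add: closure_upper_half dist_Pair_Pair dist_real_def abs_minus_commute)
    have "c \<le> VL (y, t)"
      by (rule tendsto_lowerbound[OF lower_env_limits(1)[OF t]])
        (use near d(1) in \<open>auto simp: eventually_at_left_field intro!: exI[of _ "y - d"]\<close>)
    moreover have "c \<le> VR (y, t)"
      by (rule tendsto_lowerbound[OF lower_env_limits(2)[OF t]])
        (use near d(1) in \<open>auto simp: eventually_at_right_field intro!: exI[of _ "y + d"]\<close>)
    ultimately show "c \<le> min (VL (y, t)) (VR (y, t))" by simp
  qed
qed

lemma lower_env_supersolution_at_jump: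
  assumes "0 \<le> B" "\<And>\<xi>. \<bar>H \<xi>\<bar> \<le> C" "\<And>T. 0 < T \<Longrightarrow> supersolution H T (lower_env upper_half g)"
    "\<And>x. - A - B * \<bar>x - y\<bar> \<le> lower_env upper_half g (x, 0)"
  shows "supersolution_at_jump H (lower_env upper_half g) y (\<lambda>t. VL (y, t)) (\<lambda>t. VR (y, t)) A B C"
proof
  fix c t :: real assume t: "0 < t"
  have pos: "0 \<le> snd w" if "w \<in> ball (y, t) t" for w
    using that dist_snd_le[of "(y, t)" w] by (auto simp: dist_real_def)
  { assume c: "c < VR (y, t)"
    obtain d where d: "0 < d" "\<And>w. w \<in> ball (y, t) d \<Longrightarrow> y \<le> fst w \<Longrightarrow> 0 \<le> snd w \<Longrightarrow> fst w < y + \<rho> \<and> c < VR w"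
      by (rule near_right[OF less_imp_le[OF t] c]) blast
    have "c \<le> lower_env upper_half g w" if "w \<in> ball (y, t) (min d t)" "y < fst w" for w
      using d(2)[of w] pos[of w] that lower_env_right[of "fst w" "snd w"] by auto
    then show "\<exists>d>0. \<forall>w\<in>ball (y, t) d. y < fst w \<longrightarrow> c \<le> lower_env upper_half g w"
      using d(1) t by (intro exI[of _ "min d t"]) simp }
  { assume c: "c < VL (y, t)"
    obtain d where d: "0 < d" "\<And>w. w \<in> ball (y, t) d \<Longrightarrow> fst w \<le> y \<Longrightarrow> 0 \<le> snd w \<Longrightarrow> y - \<rho> < fst w \<and> c < VL w"
      by (rule near_left[OF less_imp_le[OF t] c]) blast
    have "c \<le> lower_env upper_half g w" if "w \<in> ball (y, t) (min d t)" "fst w < y" for w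
      using d(2)[of w] pos[of w] that lower_env_left[of "fst w" "snd w"] by auto
    then show "\<exists>d>0. \<forall>w\<in>ball (y, t) d. fst w < y \<longrightarrow> c \<le> lower_env upper_half g w"
      using d(1) t by (intro exI[of _ "min d t"]) simp }
next
  show "lsc_on (UNIV \<times> {0..}) (lower_env upper_half g)"
    using lsc_on_lower_env[OF open_upper_half loc] by (simp add: closure_upper_half)
qed (use assms traces_continuous lower_env_at_jump in auto)

end

section \<open>The initial data\<close>

lemma W1inf_bounded:
  assumes "W1inf H" "continuous_on UNIV H"
  obtains C where "\<And>\<xi>. \<bar>H \<xi>\<bar> \<le> C"
proof -
  obtain C where C: "AE \<xi> in lebesgue. \<bar>H \<xi>\<bar> \<le> C"
    using assms(1) unfolding W1inf_def Linf_def by (auto simp: AE_lebesgue_on_iff)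
  have "\<bar>H \<xi>\<bar> \<le> C" for \<xi>
  proof (rule ccontr)
    assume "\<not> \<bar>H \<xi>\<bar> \<le> C"
    then have "\<xi> \<in> {\<xi>. C < \<bar>H \<xi>\<bar>}" by simp
    then have "{\<xi>. C < \<bar>H \<xi>\<bar>} \<noteq> {}" by blast
    moreover have "open {\<xi>. C < \<bar>H \<xi>\<bar>}"
      by (intro open_Collect_less continuous_intros assms(2))
    moreover have "AE \<xi> in lebesgue. \<xi> \<in> {\<xi>. C < \<bar>H \<xi>\<bar>} \<longrightarrow> False"
      using C by (rule eventually_mono) auto
    ultimately show False using AE_on_open_witness[of _ "\<lambda>_. False" False] by metis
  qed
  then show ?thesis by (rule that)
qed

text \<open>The bound is centred at \<open>y\<close>, and the additional \<open>B\<close> accounts for a ball of radius \<open>1\<close>.\<close>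

lemma lower_env_linear_growth:
  assumes B: "0 \<le> B" and g: "Linf_loc UNIV g" and growth: "AE x in lebesgue. - A - B * \<bar>x\<bar> \<le> g x"
  shows "- (A + B + B * \<bar>y\<bar>) - B * \<bar>x - y\<bar> \<le> lower_env UNIV g x"
proof (rule lower_env_ge[where \<delta> = 1])
  have "- (A + B + B * \<bar>y\<bar>) - B * \<bar>x - y\<bar> \<le> - A - B * \<bar>w\<bar>" if "w \<in> ball x 1" for w
  proof -
    have "\<bar>w\<bar> \<le> 1 + \<bar>y\<bar> + \<bar>x - y\<bar>" using that by (auto simp: dist_real_def)
    then have "B * \<bar>w\<bar> \<le> B * (1 + \<bar>y\<bar> + \<bar>x - y\<bar>)" using B by (rule mult_left_mono)
    then show ?thesis by (simp add: algebra_simps)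
  qed
  then show "AE w in lebesgue. w \<in> ball x 1 \<inter> UNIV \<longrightarrow> - (A + B + B * \<bar>y\<bar>) - B * \<bar>x - y\<bar> \<le> g w"
    by (intro eventually_mono[OF growth]) (meson IntD1 order_trans)
qed (use g in auto)

lemma lower_env_eq_on_interval:
  fixes f h :: "real \<Rightarrow> real"
  assumes f: "Linf_loc UNIV f" and h: "continuous_on {a..b} h"
    and eq: "AE w in lebesgue_on {a<..<b}. f w = h w" and x: "a < x" "x < b"
  shows "lower_env UNIV f x = h x"
proof (rule lower_env_eq_continuous_representative[OF _ _ _ h])
  define d where "d = min (x - a) (b - x)"
  have *: "a < w \<and> w < b" if "w \<in> ball x d" for w using that by (auto simp: d_def dist_real_def)
  then show "ball x d \<inter> UNIV \<subseteq> {a..b}" by force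
  show "0 < d" using x by (simp add: d_def)
  have "AE w in lebesgue. w \<in> {a<..<b} \<longrightarrow> f w = h w" using eq by (simp add: AE_lebesgue_on_iff)
  then show "AE w in lebesgue. w \<in> ball x d \<inter> UNIV \<longrightarrow> f w = h w"
    by (rule eventually_mono) (use * in auto)
qed (use f x in auto)

text \<open>The initial condition is an identity between envelopes, while the initial jump is defined by
continuous representatives. Both agree next to the point \<open>y\<close>; hence the one-sided limits of the
envelope at \<open>y\<close> are those of the representatives.\<close>

lemma right_limit_eq:
  assumes f: "Linf_loc UNIV f" and h: "continuous_on {y..b} h" "y < b"
    and eq: "AE w in lebesgue_on {y<..<b}. f w = h w"
    and lim: "((\<lambda>x. lower_env UNIV f x) \<longlongrightarrow> L) (at_right y)"
  shows "right_limit f y = L"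
proof -
  have unique: "l = L" if k: "y < c" "continuous_on {y..c} k" "AE w in lebesgue_on {y<..<c}. f w = k w"
    "(k \<longlongrightarrow> l) (at_right y)" for c k l
  proof -
    have "\<forall>\<^sub>F x in at_right y. lower_env UNIV f x = k x"
      unfolding eventually_at_right_field
      using lower_env_eq_on_interval[OF f k(2,3)] k(1) by blast
    then have "(k \<longlongrightarrow> L) (at_right y)" by (rule Lim_transform_eventually[OF lim])
    then show ?thesis using k(4) tendsto_unique[of "at_right y"] by simp
  qed
  have h_lim: "(h \<longlongrightarrow> h y) (at_right y)" using continuous_on_Icc_at_rightD[OF h] .
  moreover have "h y = L" using unique[OF h(2,1) eq h_lim] .
  ultimately have "\<exists>b g. y < b \<and> continuous_on {y..b} g \<and>
     (AE w in lebesgue_on {y<..<b}. f w = g w) \<and> (g \<longlongrightarrow> L) (at_right y)"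
    using h eq by blast
  then show ?thesis unfolding right_limit_def by (rule the_equality) (use unique in blast)
qed

lemma left_limit_eq:
  assumes f: "Linf_loc UNIV f" and h: "continuous_on {a..y} h" "a < y"
    and eq: "AE w in lebesgue_on {a<..<y}. f w = h w"
    and lim: "((\<lambda>x. lower_env UNIV f x) \<longlongrightarrow> L) (at_left y)"
  shows "left_limit f y = L"
proof -
  have unique: "l = L" if k: "c < y" "continuous_on {c..y} k" "AE w in lebesgue_on {c<..<y}. f w = k w"
    "(k \<longlongrightarrow> l) (at_left y)" for c k l
  proof -
    have "\<forall>\<^sub>F x in at_left y. lower_env UNIV f x = k x"
      unfolding eventually_at_left_field
      using lower_env_eq_on_interval[OF f k(2,3)] k(1) by blast
    then have "(k \<longlongrightarrow> L) (at_left y)" by (rule Lim_transform_eventually[OF lim])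
    then show ?thesis using k(4) tendsto_unique[of "at_left y"] by simp
  qed
  have h_lim: "(h \<longlongrightarrow> h y) (at_left y)" using continuous_on_Icc_at_leftD[OF h] .
  moreover have "h y = L" using unique[OF h(2,1) eq h_lim] .
  ultimately have "\<exists>a g. a < y \<and> continuous_on {a..y} g \<and>
     (AE w in lebesgue_on {a<..<y}. f w = g w) \<and> (g \<longlongrightarrow> L) (at_left y)"
    using h eq by blast
  then show ?thesis unfolding left_limit_def by (rule the_equality) (use unique in blast)
qed

lemma pw_continuous_interval_no_jump:
  assumes "pw_continuous_interval a b f {}"
  shows "\<exists>h. continuous_on {a..b} h \<and> (AE w in lebesgue_on {a<..<b}. f w = h w)"
  using assms unfolding pw_continuous_interval_def
proof (elim conjE exE)
  fix p :: nat and x :: "nat \<Rightarrow> real" and g :: "nat \<Rightarrow> real \<Rightarrow> real"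
  assume x: "x 0 = a" "x (p + 1) = b" "{} = x ` {1..p}"
    and g: "\<forall>j\<in>{1..p + 1}. continuous_on {x (j - 1)..x j} (g j) \<and>
           (AE y in lebesgue_on {x (j - 1)<..<x j}. f y = g j y)"
  have "p = 0" using x(3) by auto
  then show ?thesis using x(1,2) g[rule_format, of 1, unfolded diff_self_eq_0 One_nat_def]
    by (intro exI[of _ "g (Suc 0)"]) auto
qed

section \<open>Finite waiting time\<close>

lemma traces_meet:
  assumes H: "\<And>\<xi>. \<bar>H \<xi>\<bar> \<le> C"
    and B: "0 < B" and growth: "AE y in lebesgue. \<bar>U0 y\<bar> \<le> A + B * \<bar>y\<bar>"
    and U0: "Linf_loc UNIV U0" "pw_continuous_interval (y - \<rho>) y U0 {}" "pw_continuous_interval y (y + \<rho>) U0 {}"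
    and U: "global_viscosity_solution H U0 U"
    and V: "strip_representatives U VL VR y \<rho>"
    and const: "(0 < initial_jump U0 y \<and> \<not> (\<exists>c>0. H constant_on {c<..})) \<or>
      (initial_jump U0 y < 0 \<and> \<not> (\<exists>d<0. H constant_on {..<d}))"
  shows "\<exists>s\<ge>0. \<forall>t\<ge>s. VL (y, t) = VR (y, t)"
proof -
  interpret V: strip_representatives U VL VR y \<rho> by (rule V)
  interpret W: strip_representatives "\<lambda>w. - U w" "\<lambda>w. - VL w" "\<lambda>w. - VR w" y \<rho> by (rule V.uminus)
  define A' where "A' = A + B + B * \<bar>y\<bar>"
  have vs: "viscosity_solution H T U" if "0 < T" for T
    using U that by (simp add: global_viscosity_solution_def cauchy_viscosity_solution_def)
  have env0: "lower_env upper_half U (x, 0) = lower_env UNIV U0 x"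
    "lower_env upper_half (\<lambda>w. - U w) (x, 0) = lower_env UNIV (\<lambda>w. - U0 w) x" for x
  proof -
    have c: "upper_env (Q_domain 1) U (x, 0) = upper_env UNIV U0 x"
      "lower_env (Q_domain 1) U (x, 0) = lower_env UNIV U0 x"
      using U by (auto simp: global_viscosity_solution_def cauchy_viscosity_solution_def)
    show "lower_env upper_half U (x, 0) = lower_env UNIV U0 x"
      using c(2) lower_env_Q_domain[of "(x, 0)" 1 U] by simp
    have "open (Q_domain 1)" unfolding Q_domain_def by (intro open_Times) auto
    then have "lower_env (Q_domain 1) (\<lambda>w. - U w) (x, 0) = - upper_env (Q_domain 1) U (x, 0)"
      by (rule lower_env_uminus) (use vs[of 1] in \<open>auto simp: closure_Q_domain viscosity_solution_def\<close>)
    moreover have "lower_env UNIV (\<lambda>w. - U0 w) x = - upper_env UNIV U0 x"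
      by (rule lower_env_uminus) (use U0 in auto)
    ultimately show "lower_env upper_half (\<lambda>w. - U w) (x, 0) = lower_env UNIV (\<lambda>w. - U0 w) x"
      using c(1) lower_env_Q_domain[of "(x, 0)" 1 "\<lambda>w. - U w"] by simp
  qed
  \<comment> \<open>The two one-sided problems to which the results on the evolution of the jump apply;
    a downward jump is turned into an upward one by reflection.\<close>
  have lower: "supersolution_at_jump H (lower_env upper_half U) y (\<lambda>t. VL (y, t)) (\<lambda>t. VR (y, t)) A' B C"
    unfolding A'_def
  proof (rule V.lower_env_supersolution_at_jump[OF less_imp_le[OF B] H viscosity_solution_lower_env[OF vs]])
    show "- (A + B + B * \<bar>y\<bar>) - B * \<bar>x - y\<bar> \<le> lower_env upper_half U (x, 0)" for x
      unfolding env0 by (rule lower_env_linear_growth[OF less_imp_le[OF B] U0(1)])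
        (use growth in \<open>auto elim!: eventually_mono\<close>)
  qed
  have upper: "supersolution_at_jump (\<lambda>\<xi>. - H (- \<xi>)) (lower_env upper_half (\<lambda>w. - U w)) y
     (\<lambda>t. - VL (y, t)) (\<lambda>t. - VR (y, t)) A' B C"
    unfolding A'_def
  proof (rule W.lower_env_supersolution_at_jump[OF less_imp_le[OF B] _ viscosity_solution_lower_env_uminus[OF vs]])
    show "- (A + B + B * \<bar>y\<bar>) - B * \<bar>x - y\<bar> \<le> lower_env upper_half (\<lambda>w. - U w) (x, 0)" for x
      unfolding env0 by (rule lower_env_linear_growth[OF less_imp_le[OF B] Linf_loc_uminus[OF U0(1)]])
        (use growth in \<open>auto elim!: eventually_mono\<close>)
  qed (use H in auto)
  have jump0: "initial_jump U0 y = VR (y, 0) - VL (y, 0)"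
  proof -
    obtain h where h: "continuous_on {y..y + \<rho>} h" "AE w in lebesgue_on {y<..<y + \<rho>}. U0 w = h w"
      using pw_continuous_interval_no_jump[OF U0(3)] by blast
    obtain k where k: "continuous_on {y - \<rho>..y} k" "AE w in lebesgue_on {y - \<rho><..<y}. U0 w = k w"
      using pw_continuous_interval_no_jump[OF U0(2)] by blast
    have "right_limit U0 y = VR (y, 0)"
      using right_limit_eq[OF U0(1) h(1) _ h(2)] V.lower_env_limits(2)[of 0] V.\<rho>_pos by (simp add: env0)
    moreover have "left_limit U0 y = VL (y, 0)"
      using left_limit_eq[OF U0(1) k(1) _ k(2)] V.lower_env_limits(1)[of 0] V.\<rho>_pos by (simp add: env0)
    ultimately show ?thesis by (simp add: initial_jump_def)
  qed
  from const show ?thesis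
  proof
    assume *: "0 < initial_jump U0 y \<and> \<not> (\<exists>c>0. H constant_on {c<..})"
    show ?thesis
      by (rule upward_jump_closes_for_good[OF lower])
        (use supersolution_at_jump.reflected[OF upper] * jump0 B in auto)
  next
    assume *: "initial_jump U0 y < 0 \<and> \<not> (\<exists>d<0. H constant_on {..<d})"
    have "\<not> (\<lambda>\<xi>. H (- \<xi>)) constant_on {B<..}"
    proof
      assume "(\<lambda>\<xi>. H (- \<xi>)) constant_on {B<..}"
      then obtain c where c: "\<And>\<xi>. B < \<xi> \<Longrightarrow> H (- \<xi>) = c" unfolding constant_on_def by auto
      have "H constant_on {..< - B}" unfolding constant_on_def
        by (rule exI[of _ c]) (use c[of "- \<xi>" for \<xi>] in \<open>force\<close>)
      then show False using * B by auto
    qed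
    then have "\<exists>s\<ge>0. \<forall>t\<ge>s. VR (y, t) = VL (y, t)"
      by (intro upward_jump_closes_for_good[OF supersolution_at_jump.reflected[OF lower] upper])
        (use * jump0 in auto)
    then show ?thesis by metis
  qed
qed

lemma open_strip: "open (strip p x j)"
proof -
  have "strip p x j = ((if 1 < j then {x (j - 1)<..} else UNIV) \<inter> (if j \<le> p then {..<x j} else UNIV)) \<times> {0<..}"
    by (auto simp: strip_def)
  moreover have "open \<dots>" by (intro open_Times open_Int) simp_all
  ultimately show ?thesis by simp
qed

lemma continuous_representative_on_rectangle:
  assumes V: "continuous_representative (strip p x j) U V"
    and sub: "{a<..<b} \<times> {0<..} \<subseteq> strip p x j" and ab: "a < b"
  shows "continuous_on ({a..b} \<times> {0..}) V"
    and "AE w in lebesgue. w \<in> {a<..<b} \<times> {0<..} \<longrightarrow> U w = V w"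
proof -
  have "{a..b} \<times> {0..} = closure ({a<..<b} \<times> {0::real<..})" using ab by (simp add: closure_Times)
  also have "\<dots> \<subseteq> closure (strip p x j)" by (rule closure_mono[OF sub])
  finally show "continuous_on ({a..b} \<times> {0..}) V"
    using V unfolding continuous_representative_def by (blast intro: continuous_on_subset)
  have "strip p x j \<in> sets lebesgue" using open_strip by (auto intro: borel_open)
  then have "AE w in lebesgue. w \<in> strip p x j \<longrightarrow> U w = V w"
    using V unfolding continuous_representative_def by (simp add: AE_lebesgue_on_iff)
  then show "AE w in lebesgue. w \<in> {a<..<b} \<times> {0<..} \<longrightarrow> U w = V w"
    by (rule eventually_mono) (use sub in blast)
qed

theorem theorem4p5:
  fixes H U0 :: "real \<Rightarrow> real" and p :: nat and x :: "nat \<Rightarrow> real" and A B :: real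
    and U :: "real \<times> real \<Rightarrow> real" and V :: "nat \<Rightarrow> real \<times> real \<Rightarrow> real"
  assumes H: "W1inf H" and H_cont: "continuous_on UNIV H"
    and x_strict: "strict_mono_on {1..p} x"
    and U0: "pw_continuous U0 (x ` {1..p})"
    and AB: "A > 0" "B > 0"
    and growth: "AE y in lebesgue. \<bar>U0 y\<bar> \<le> A + B * \<bar>y\<bar>"
    and U: "global_viscosity_solution H U0 U"
    and V: "\<forall>j\<in>{1..p + 1}. continuous_representative (strip p x j) U (V j)"
  shows "\<forall>j\<in>{1..p}.
    (initial_jump U0 (x j) > 0 \<and> (\<exists>L. (H \<longlongrightarrow> L) at_top) \<and> \<not> (\<exists>c>0. H constant_on {c<..}))
    \<or> (initial_jump U0 (x j) < 0 \<and> (\<exists>L. (H \<longlongrightarrow> L) at_bot) \<and> \<not> (\<exists>d<0. H constant_on {..<d}))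
    \<longrightarrow> waiting_time V x j < \<infinity>"
proof (intro ballI impI)
  fix j assume j: "j \<in> {1..p}"
    and cases: "(initial_jump U0 (x j) > 0 \<and> (\<exists>L. (H \<longlongrightarrow> L) at_top) \<and> \<not> (\<exists>c>0. H constant_on {c<..}))
    \<or> (initial_jump U0 (x j) < 0 \<and> (\<exists>L. (H \<longlongrightarrow> L) at_bot) \<and> \<not> (\<exists>d<0. H constant_on {..<d}))"
  obtain C where C: "\<And>\<xi>. \<bar>H \<xi>\<bar> \<le> C" by (rule W1inf_bounded[OF H H_cont]) blast
  \<comment> \<open>No other discontinuity is closer than \<open>\<rho>\<close> to \<open>x j\<close>.\<close>
  obtain \<rho> where \<rho>: "0 < \<rho>" "\<And>v. v \<in> x ` {1..p} \<Longrightarrow> v \<noteq> x j \<Longrightarrow> \<rho> \<le> dist (x j) v"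
    using finite_set_avoid[of "x ` {1..p}" "x j"] by auto
  have left: "x (j - 1) \<le> x j - \<rho>" if "1 < j"
  proof -
    have "j - 1 \<in> {1..p}" using j that unfolding atLeastAtMost_iff by linarith
    moreover from this have "x (j - 1) < x j" using strict_mono_onD[OF x_strict, of "j - 1" j] j that by auto
    ultimately show ?thesis using \<rho>(2)[of "x (j - 1)"] by (auto simp: dist_real_def)
  qed
  have right: "x j + \<rho> \<le> x (j + 1)" if "j + 1 \<le> p"
  proof -
    have "x j < x (j + 1)" using strict_mono_onD[OF x_strict, of j "j + 1"] j that by auto
    then show ?thesis using \<rho>(2)[of "x (j + 1)"] j that by (auto simp: dist_real_def)
  qed
  have subL: "{x j - \<rho><..<x j} \<times> {0<..} \<subseteq> strip p x j" and subR: "{x j<..<x j + \<rho>} \<times> {0<..} \<subseteq> strip p x (j + 1)"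
    using left right by (auto simp: strip_def)
  have Uloc: "Linf_loc (closure (Q_domain T)) U" if "0 < T" for T
    using U that by (simp add: global_viscosity_solution_def cauchy_viscosity_solution_def viscosity_solution_def)
  have VL: "continuous_representative (strip p x j) U (V j)"
    and VR: "continuous_representative (strip p x (j + 1)) U (V (j + 1))"
    using V j by auto
  have traces: "strip_representatives U (V j) (V (j + 1)) (x j) \<rho>"
    using \<rho>(1) Linf_loc_upper_half[OF Uloc] continuous_representative_on_rectangle[OF VL subL]
      continuous_representative_on_rectangle[OF VR subR]
    by unfold_locales auto
  have "x ` {1..p} \<inter> {x j - \<rho><..<x j} = {}" "x ` {1..p} \<inter> {x j<..<x j + \<rho>} = {}"
    using \<rho>(2) by (force simp: dist_real_def)+
  then have pw: "pw_continuous_interval (x j - \<rho>) (x j) U0 {}" "pw_continuous_interval (x j) (x j + \<rho>) U0 {}"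
    using U0 \<rho>(1) unfolding pw_continuous_def by (metis diff_less_eq less_add_same_cancel1)+
  have "Linf_loc UNIV U0" using U0 by (simp add: pw_continuous_def)
  then obtain s where s: "\<And>t. s \<le> t \<Longrightarrow> V j (x j, t) = V (j + 1) (x j, t)"
    using traces_meet[OF C AB(2) growth _ pw U traces] cases by auto
  have "waiting_time V x j \<le> ereal s"
    unfolding waiting_time_def
  proof (rule Sup_least, clarify)
    fix t assume "jump V x j t \<noteq> 0"
    then show "ereal t \<le> ereal s" using s[of t] by (force simp: jump_def)
  qed
  then show "waiting_time V x j < \<infinity>" using le_less_trans by force
qed

end
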